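(* There exist a finite connected weighted graph $G=(V,(c_{xy})_{x,y\in V})$ and site weights $\hat\alpha=(\hat\alpha_x)_{x\in V}\in(0,\infty)^V$ such that $$\lim_{\varepsilon\to 0}\frac{{\rm gap}_2(G,\varepsilon\hat\alpha)}{{\rm gap}_1(G,\varepsilon\hat\alpha)}<1,$$ where $\varepsilon>0$ and $\varepsilon\hat\alpha=(\varepsilon\hat\alpha_x)_{x\in V}$.
   Context: $G=(V,(c_{xy})_{x,y\in V})$ is a finite graph with $|V|\ge2$, symmetric conductances $c_{xy}=c_{yx}\ge 0$, $c_{xx}=0$, connected: any two sites are joined by a sequence of sites with positive conductance between consecutive ones. For positive site weights $\alpha=(\alpha_x)_{x\in V}$ and $k\in\mathbb N$ let $\Xi_k=\{\eta\in\mathbb N_0^V:\sum_{x\in V}\eta_x=k\}$. The symmetric inclusion process ${\rm SIP}_k(G,\alpha)$ is the continuous-time Markov chain on $\Xi_k$ with generator, for $f\in\mathbb R^{\Xi_k}$, $$L_{G,\alpha,k}f(\eta)=\sum_{x,y\in V}c_{xy}\,\eta_x(\alpha_y+\eta_y)\big(f(\eta-\delta_x+\delta_y)-f(\eta)\big).$$ It is irreducible and reversible, so all eigenvalues of $-L_{G,\alpha,k}$ are real and non-negative, with $0$ simple; ${\rm gap}_k(G,\alpha)>0$ denotes the second smallest eigenvalue of $-L_{G,\alpha,k}$. (For $k=1$ this is the spectral gap of the random walk on $V$ jumping from $x$ to $y$ at rate $c_{xy}\alpha_y$.) *)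

theory Defs
  imports Complex_Main
begin

text \<open>Weighted graphs have an explicit vertex set inside a type; values of \<open>c\<close> (and of site
  weights) outside the vertex set are irrelevant.\<close>

definition weighted_graph :: "'v set \<Rightarrow> ('v \<Rightarrow> 'v \<Rightarrow> real) \<Rightarrow> bool" where
  "weighted_graph V c \<longleftrightarrow>
     finite V \<and> card V \<ge> 2 \<and>
     (\<forall>x\<in>V. \<forall>y\<in>V. c x y = c y x \<and> c x y \<ge> 0) \<and>
     (\<forall>x\<in>V. c x x = 0) \<and>
     (\<forall>x\<in>V. \<forall>y\<in>V. (x, y) \<in> {(u, v). u \<in> V \<and> v \<in> V \<and> c u v > 0}\<^sup>*)"

text \<open>Elements of \<open>\<nat>\<^sub>0\<^sup>V\<close> are represented by their extension by \<open>0\<close> outside \<open>V\<close>.\<close>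

definition configs :: "'v set \<Rightarrow> nat \<Rightarrow> ('v \<Rightarrow> nat) set" where
  "configs V k = {\<eta>. (\<forall>x. x \<notin> V \<longrightarrow> \<eta> x = 0) \<and> (\<Sum>x\<in>V. \<eta> x) = k}"

text \<open>The configuration \<open>\<eta> - \<delta>\<^sub>x + \<delta>\<^sub>y\<close>. The subtraction truncates when \<open>\<eta> x = 0\<close>, but
  in the generator such a term carries the rate \<open>0\<close>.\<close>

definition move :: "('v \<Rightarrow> nat) \<Rightarrow> 'v \<Rightarrow> 'v \<Rightarrow> ('v \<Rightarrow> nat)" where
  "move \<eta> x y = (\<lambda>z. \<eta> z - (if z = x then 1 else 0) + (if z = y then 1 else 0))"

definition sip_gen ::
  "'v set \<Rightarrow> ('v \<Rightarrow> 'v \<Rightarrow> real) \<Rightarrow> ('v \<Rightarrow> real) \<Rightarrow> (('v \<Rightarrow> nat) \<Rightarrow> real) \<Rightarrow> ('v \<Rightarrow> nat) \<Rightarrow> real" where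
  "sip_gen V c \<alpha> f \<eta> =
     (\<Sum>x\<in>V. \<Sum>y\<in>V. c x y * real (\<eta> x) * (\<alpha> y + real (\<eta> y)) * (f (move \<eta> x y) - f \<eta>))"

text \<open>Eigenvalues of \<open>-L\<close> acting on \<open>\<real>\<^sup>\<Xi>\<close> with \<open>\<Xi> = configs V k\<close>. For \<open>\<eta> \<in> \<Xi>\<close>,
  \<open>sip_gen V c \<alpha> f \<eta>\<close> depends only on the restriction of \<open>f\<close> to \<open>\<Xi>\<close>, so functions on \<open>\<Xi>\<close> are
  represented by arbitrary extensions. By reversibility all eigenvalues are real.\<close>

definition sip_eigenvalues ::
  "'v set \<Rightarrow> ('v \<Rightarrow> 'v \<Rightarrow> real) \<Rightarrow> ('v \<Rightarrow> real) \<Rightarrow> nat \<Rightarrow> real set" where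
  "sip_eigenvalues V c \<alpha> k =
     {l. \<exists>f. (\<exists>\<eta>\<in>configs V k. f \<eta> \<noteq> 0) \<and>
             (\<forall>\<eta>\<in>configs V k. - sip_gen V c \<alpha> f \<eta> = l * f \<eta>)}"

text \<open>The second smallest eigenvalue. The smallest eigenvalue, \<open>0\<close>, is simple, so it makes no
  difference whether eigenvalues are counted with multiplicity. For a weighted graph, positive
  \<open>\<alpha>\<close> and \<open>k \<ge> 1\<close> both minima are over finite nonempty sets.\<close>

definition gap ::
  "'v set \<Rightarrow> ('v \<Rightarrow> 'v \<Rightarrow> real) \<Rightarrow> ('v \<Rightarrow> real) \<Rightarrow> nat \<Rightarrow> real" where
  "gap V c \<alpha> k =
     Min (sip_eigenvalues V c \<alpha> k - {Min (sip_eigenvalues V c \<alpha> k)})"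

end

theory Submission
  imports Defs "HOL-Analysis.Function_Topology"
begin

text \<open>For weights \<open>\<epsilon>\<alpha>\<close> with small \<open>\<epsilon>\<close>, two particles on neighbouring sites merge at rate of order
\<open>1\<close>, while every other jump has rate of order \<open>\<epsilon>\<close>. On the time scale \<open>1/\<epsilon>\<close> the two-particle
process therefore sees only two kinds of states: both particles on one site, or the particles on
two distinct non-adjacent sites. A merged pair performs the one-particle walk: its slow
excursion to an edge ends, with probability \<open>1/2\<close> each, at either endpoint. A separated pair
walks as two independent particles until they become adjacent; they then merge, and in the
limit a merged pair is never separated again. The slow generator is block triangular, and its spectrum
consists of that of the one-particle walk and that of two independent walkers killed when they
become adjacent. The ratio of gaps drops below \<open>1\<close> as soon as the smallest killed eigenvalue
lies below the one-particle gap \<open>g\<close>, that is, when two walkers take longer to meet than one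
walker takes to relax.

This calls for a graph that mixes fast and in which distant sites have few common neighbours. Take
unit conductances and \<open>\<alpha> = 1\<close>, and suppose that every two distinct non-adjacent sites have exactly
\<open>\<mu>\<close> common neighbours. Each of the two particles of a separated pair then becomes adjacent to the
other one at rate \<open>\<mu>\<close>, so the killed walk is left at the constant rate \<open>2\<mu>\<close>; this is its smallest
eigenvalue, with the indicator of the separated pairs as eigenfunction. If \<open>2\<mu> < g\<close>, the limit of
the ratio is \<open>2\<mu>/g\<close>. The \<open>q \<times> q\<close> rook graph has \<open>\<mu> = 2\<close> and \<open>g = q\<close>, and \<open>q = 5\<close> gives the limit
\<open>4/5\<close>.

The proof works with Rayleigh quotients. For a reversible operator on a finite set the second smallest
eigenvalue is the least Rayleigh quotient of a function of mean zero (\<open>second_eigenvalue\<close>). With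
two labelled particles a function becomes a symmetric \<open>F\<close> on \<open>V \<times> V\<close>, and its Rayleigh quotient is
\<open>\<epsilon> (\<epsilon>P + 2Q) / (\<epsilon>S + T)\<close>, where \<open>S\<close> and \<open>T\<close> are the squared norms of \<open>F\<close> on \<open>V \<times> V\<close> and on its
diagonal, \<open>P\<close> is the energy of the walk of one particle with the other one fixed, and \<open>Q\<close> measures how
\<open>F\<close> differs between an edge and its endpoints. The indicator of the separated pairs has \<open>Q = T = 0\<close>
and \<open>P = 2\<mu>S\<close>, which bounds the gap from above; the matching lower bound is
\<open>slow_energy_lower_bound\<close>.\<close>

section \<open>Reversible operators on finite sets\<close>

text \<open>A reversible generator enters only through its Dirichlet form: the operator \<open>A\<close> (minus the generator)
has the quadratic form of a network with edges \<open>j \<in> J\<close> of conductance \<open>k j\<close> joining \<open>p j\<close> to \<open>q j\<close>.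
Because the weights are positive, this identity determines \<open>A f\<close> on the states; linearity,
symmetry, positivity and \<open>A 1 = 0\<close> follow from it. Edges may be indexed with repetitions,
so labelled particles can be used to index transitions between unlabelled configurations.\<close>

locale reversible_operator =
  fixes X :: "'s set" and w :: "'s \<Rightarrow> real" and A :: "('s \<Rightarrow> real) \<Rightarrow> 's \<Rightarrow> real"
    and J :: "'j set" and k :: "'j \<Rightarrow> real" and p q :: "'j \<Rightarrow> 's"
  assumes finite_states: "finite X"
    and weight_pos: "\<eta> \<in> X \<Longrightarrow> w \<eta> > 0"
    and rate_nonneg: "j \<in> J \<Longrightarrow> k j \<ge> 0"
    and dirichlet_form:
      "(\<Sum>\<eta>\<in>X. w \<eta> * f \<eta> * A g \<eta>) = (\<Sum>j\<in>J. k j * (f (p j) - f (q j)) * (g (p j) - g (q j)))"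
begin

definition inner_w :: "('s \<Rightarrow> real) \<Rightarrow> ('s \<Rightarrow> real) \<Rightarrow> real" where
  "inner_w f g = (\<Sum>\<eta>\<in>X. w \<eta> * f \<eta> * g \<eta>)"

definition energy :: "('s \<Rightarrow> real) \<Rightarrow> ('s \<Rightarrow> real) \<Rightarrow> real" where
  "energy f g = (\<Sum>j\<in>J. k j * (f (p j) - f (q j)) * (g (p j) - g (q j)))"

definition spectrum :: "real set" where
  "spectrum = {l. \<exists>f. (\<exists>\<eta>\<in>X. f \<eta> \<noteq> 0) \<and> (\<forall>\<eta>\<in>X. A f \<eta> = l * f \<eta>)}"

lemma inner_A: "inner_w f (A g) = energy f g"
  by (simp add: inner_w_def energy_def dirichlet_form)

lemma inner_commute: "inner_w f g = inner_w g f"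
  by (simp add: inner_w_def mult_ac)

lemma energy_commute: "energy f g = energy g f"
  by (simp add: energy_def mult_ac)

lemma energy_nonneg: "energy f f \<ge> 0"
  unfolding energy_def by (intro sum_nonneg) (simp add: rate_nonneg mult.assoc)

lemma energy_shift: "energy (\<lambda>\<eta>. f \<eta> - c) g = energy f g" "energy f (\<lambda>\<eta>. g \<eta> - c) = energy f g"
  by (simp_all add: energy_def)

lemma energy_const: "energy f (\<lambda>_. c) = 0"
  by (simp add: energy_def)

lemma energy_lin: "energy f (\<lambda>\<eta>. g \<eta> + t * h \<eta>) = energy f g + t * energy f h"
  by (simp add: energy_def sum_distrib_left algebra_simps flip: sum.distrib)

lemma inner_lin: "inner_w f (\<lambda>\<eta>. g \<eta> + t * h \<eta>) = inner_w f g + t * inner_w f h"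
  by (simp add: inner_w_def sum_distrib_left algebra_simps flip: sum.distrib)

lemma inner_cong: "(\<And>\<eta>. \<eta> \<in> X \<Longrightarrow> f \<eta> = f' \<eta>) \<Longrightarrow> (\<And>\<eta>. \<eta> \<in> X \<Longrightarrow> g \<eta> = g' \<eta>)
    \<Longrightarrow> inner_w f g = inner_w f' g'"
  by (simp add: inner_w_def)

lemma inner_nonneg: "inner_w f f \<ge> 0"
  unfolding inner_w_def by (intro sum_nonneg) (simp add: weight_pos less_imp_le mult.assoc)

lemma inner_eq_0_iff: "inner_w f f = 0 \<longleftrightarrow> (\<forall>\<eta>\<in>X. f \<eta> = 0)"
proof -
  have "inner_w f f = 0 \<longleftrightarrow> (\<forall>\<eta>\<in>X. w \<eta> * f \<eta> * f \<eta> = 0)"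
    unfolding inner_w_def using finite_states
    by (intro sum_nonneg_eq_0_iff) (auto simp: weight_pos less_imp_le mult.assoc)
  then show ?thesis using weight_pos by fastforce
qed

lemma inner_pos: "\<exists>\<eta>\<in>X. f \<eta> \<noteq> 0 \<Longrightarrow> inner_w f f > 0"
  using inner_eq_0_iff[of f] inner_nonneg[of f] by fastforce

lemma eq_on_states_if_inner_eq:
  assumes "\<And>h. inner_w h f = inner_w h g" "\<eta> \<in> X"
  shows "f \<eta> = g \<eta>"
proof -
  have "inner_w (\<lambda>\<eta>. f \<eta> - g \<eta>) (\<lambda>\<eta>. f \<eta> + (-1) * g \<eta>) = 0"
    unfolding inner_lin by (simp add: assms(1))
  then show ?thesis using inner_eq_0_iff[of "\<lambda>\<eta>. f \<eta> - g \<eta>"] assms(2) by simp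
qed

lemma eigen_energy:
  assumes "\<forall>\<eta>\<in>X. A f \<eta> = l * f \<eta>"
  shows "energy g f = l * inner_w g f"
proof -
  have "inner_w g (A f) = inner_w g (\<lambda>\<eta>. 0 + l * f \<eta>)"
    using assms by (intro inner_cong) auto
  also have "\<dots> = inner_w g (\<lambda>_. 0) + l * inner_w g f" by (rule inner_lin)
  finally show ?thesis by (simp add: inner_A) (simp add: inner_w_def)
qed

lemma eigen_orthogonal:
  assumes "\<forall>\<eta>\<in>X. A f \<eta> = l * f \<eta>" "\<forall>\<eta>\<in>X. A g \<eta> = l' * g \<eta>" "l \<noteq> l'"
  shows "inner_w f g = 0"
  using eigen_energy[OF assms(1), of g] eigen_energy[OF assms(2), of f] assms(3)
  by (simp add: energy_commute[of g f] inner_commute[of g f])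

text \<open>Normalised eigenfunctions for distinct eigenvalues are orthonormal. Bessel's inequality for the
point mass at \<open>\<xi>\<close> bounds the sum of their squares at \<open>\<xi>\<close> by \<open>1 / w \<xi>\<close>, and adding up over \<open>\<xi>\<close> with the
weights \<open>w \<xi>\<close> shows that there are at most \<open>card X\<close> of them.\<close>

lemma finite_spectrum: "finite spectrum"
proof -
  have "card L \<le> card X" if L: "L \<subseteq> spectrum" "finite L" for L
  proof -
    have "\<forall>l\<in>L. \<exists>f. inner_w f f = 1 \<and> (\<forall>\<eta>\<in>X. A f \<eta> = l * f \<eta>)"
    proof
      fix l assume "l \<in> L"
      then obtain f where f: "\<exists>\<eta>\<in>X. f \<eta> \<noteq> 0" "\<forall>\<eta>\<in>X. A f \<eta> = l * f \<eta>"
        using L(1) unfolding spectrum_def by blast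
      define s where "s = 1 / sqrt (inner_w f f)"
      define g where "g = (\<lambda>\<eta>. s * f \<eta>)"
      have pos: "inner_w f f > 0" by (rule inner_pos[OF f(1)])
      have "inner_w g g = s * s * inner_w f f"
        by (simp add: inner_w_def g_def sum_distrib_left mult_ac)
      then have "inner_w g g = 1" using pos by (simp add: s_def)
      moreover have "A g \<eta> = l * g \<eta>" if "\<eta> \<in> X" for \<eta>
      proof (rule eq_on_states_if_inner_eq[OF _ that])
        fix h
        have "energy h g = s * energy h f"
          by (simp add: energy_def g_def sum_distrib_left algebra_simps)
        also have "\<dots> = s * (l * inner_w h f)" by (simp add: eigen_energy[OF f(2)])
        also have "\<dots> = inner_w h (\<lambda>\<eta>. l * g \<eta>)"
          by (simp add: inner_w_def g_def sum_distrib_left mult_ac)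
        finally show "inner_w h (A g) = inner_w h (\<lambda>\<eta>. l * g \<eta>)" by (simp add: inner_A)
      qed
      ultimately show "\<exists>f. inner_w f f = 1 \<and> (\<forall>\<eta>\<in>X. A f \<eta> = l * f \<eta>)" by blast
    qed
    then obtain u where u: "\<And>l. l \<in> L \<Longrightarrow> inner_w (u l) (u l) = 1"
        "\<And>l. l \<in> L \<Longrightarrow> \<forall>\<eta>\<in>X. A (u l) \<eta> = l * u l \<eta>"
      by metis
    have orth: "inner_w (u l) (u l') = (if l = l' then 1 else 0)" if "l \<in> L" "l' \<in> L" for l l'
      using that u eigen_orthogonal[of "u l" l "u l'" l'] by auto
    have bessel: "w \<xi> * (\<Sum>l\<in>L. u l \<xi> * u l \<xi>) \<le> 1" if \<xi>: "\<xi> \<in> X" for \<xi>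
    proof -
      define s where "s = (\<lambda>\<eta>. \<Sum>l\<in>L. u l \<xi> * u l \<eta>)"
      have s2: "(\<Sum>\<eta>\<in>X. w \<eta> * s \<eta> * s \<eta>) = s \<xi>"
      proof -
        have "(\<Sum>\<eta>\<in>X. w \<eta> * s \<eta> * s \<eta>)
            = (\<Sum>\<eta>\<in>X. \<Sum>l\<in>L. \<Sum>l'\<in>L. u l \<xi> * u l' \<xi> * (w \<eta> * u l \<eta> * u l' \<eta>))"
        proof (intro sum.cong refl)
          fix \<eta>
          have "w \<eta> * s \<eta> * s \<eta> = w \<eta> * (\<Sum>l\<in>L. \<Sum>l'\<in>L. (u l \<xi> * u l \<eta>) * (u l' \<xi> * u l' \<eta>))"
            by (simp add: s_def sum_product mult.assoc)
          then show "w \<eta> * s \<eta> * s \<eta> = (\<Sum>l\<in>L. \<Sum>l'\<in>L. u l \<xi> * u l' \<xi> * (w \<eta> * u l \<eta> * u l' \<eta>))"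
            by (simp add: sum_distrib_left mult_ac)
        qed
        also have "\<dots> = (\<Sum>l\<in>L. \<Sum>l'\<in>L. u l \<xi> * u l' \<xi> * inner_w (u l) (u l'))"
          unfolding inner_w_def sum_distrib_left
          by (subst sum.swap, intro sum.cong refl, rule sum.swap)
        also have "\<dots> = (\<Sum>l\<in>L. \<Sum>l'\<in>L. if l = l' then u l \<xi> * u l' \<xi> else 0)"
          by (intro sum.cong refl) (simp add: orth)
        also have "\<dots> = s \<xi>" using L(2) by (simp add: s_def)
        finally show ?thesis .
      qed
      \<comment> \<open>\<open>w \<xi> * s\<close> is the orthogonal projection of the point mass at \<open>\<xi>\<close> onto the span of the \<open>u l\<close>\<close>
      let ?e = "\<lambda>\<eta>. (if \<eta> = \<xi> then 1 else 0) - w \<xi> * s \<eta>"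
      have "0 \<le> inner_w ?e ?e" by (rule inner_nonneg)
      also have "inner_w ?e ?e = (\<Sum>\<eta>\<in>X. (if \<eta> = \<xi> then w \<xi> - 2 * w \<xi> * w \<xi> * s \<xi> else 0)
            + w \<xi> * w \<xi> * (w \<eta> * s \<eta> * s \<eta>))"
        unfolding inner_w_def by (intro sum.cong refl) (simp add: algebra_simps)
      also have "\<dots> = w \<xi> - 2 * w \<xi> * w \<xi> * s \<xi> + w \<xi> * w \<xi> * s \<xi>"
        using \<xi> finite_states by (simp add: sum.distrib sum_distrib_left[symmetric] s2)
      also have "\<dots> = w \<xi> * (1 - w \<xi> * s \<xi>)" by (simp add: algebra_simps)
      finally have "0 \<le> w \<xi> * (1 - w \<xi> * s \<xi>)" .
      then show ?thesis using weight_pos[OF \<xi>] by (simp add: zero_le_mult_iff s_def)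
    qed
    have "real (card L) = (\<Sum>l\<in>L. inner_w (u l) (u l))" by (simp add: u)
    also have "\<dots> = (\<Sum>\<xi>\<in>X. w \<xi> * (\<Sum>l\<in>L. u l \<xi> * u l \<xi>))"
      unfolding inner_w_def sum_distrib_left by (subst sum.swap) (simp add: mult.assoc)
    also have "\<dots> \<le> (\<Sum>\<xi>\<in>X. 1)" by (intro sum_mono bessel)
    finally show ?thesis by simp
  qed
  then show ?thesis
    using finite_if_finite_subsets_card_bdd[of spectrum "card X"] by blast
qed

lemma zero_in_spectrum:
  assumes "X \<noteq> {}"
  shows "0 \<in> spectrum"
proof -
  have "A (\<lambda>_. 1) \<eta> = 0" if "\<eta> \<in> X" for \<eta>
    by (rule eq_on_states_if_inner_eq[OF _ that, of "A (\<lambda>_. 1)" "\<lambda>_. 0"])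
       (simp add: inner_A energy_const, simp add: inner_w_def)
  then show ?thesis using assms unfolding spectrum_def by (intro CollectI exI[of _ "\<lambda>_. 1"]) auto
qed

lemma spectrum_nonneg:
  assumes "l \<in> spectrum"
  shows "l \<ge> 0"
proof -
  obtain f where f: "\<exists>\<eta>\<in>X. f \<eta> \<noteq> 0" "\<forall>\<eta>\<in>X. A f \<eta> = l * f \<eta>"
    using assms unfolding spectrum_def by blast
  show ?thesis
    using eigen_energy[OF f(2), of f] energy_nonneg[of f] inner_pos[OF f(1)]
    by (simp add: zero_le_mult_iff)
qed

lemma Min_spectrum:
  assumes "X \<noteq> {}"
  shows "Min spectrum = 0"
  by (rule Min_eqI[OF finite_spectrum spectrum_nonneg zero_in_spectrum[OF assms]])

definition centred_sphere :: "('s \<Rightarrow> real) set" where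
  "centred_sphere =
     {f. (\<forall>\<eta>. \<eta> \<notin> X \<longrightarrow> f \<eta> = 0) \<and> inner_w f f = 1 \<and> inner_w f (\<lambda>_. 1) = 0}"

text \<open>The functions vanish off the finite set of states and are bounded on it, so the sphere is a closed
subset of a product of compact intervals, which is compact for the topology of pointwise convergence.\<close>

lemma compact_centred_sphere: "compact centred_sphere"
proof -
  define R where "R = (\<lambda>\<eta>. if \<eta> \<in> X then {- (1 + 1 / w \<eta>) .. 1 + 1 / w \<eta>} else {0})"
  have "compactin (product_topology (\<lambda>_. euclidean) UNIV) (PiE UNIV R)"
    unfolding compactin_PiE by (auto simp: R_def compactin_euclidean_iff)
  then have "compact (PiE UNIV R)"
    by (simp add: euclidean_product_topology compactin_euclidean_iff)
  moreover have "closed {f :: 's \<Rightarrow> real. inner_w f f = 1}"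
    unfolding inner_w_def by (intro closed_Collect_eq continuous_intros) auto
  moreover have "closed {f :: 's \<Rightarrow> real. inner_w f (\<lambda>_. 1) = 0}"
    unfolding inner_w_def by (intro closed_Collect_eq continuous_intros) auto
  ultimately have "compact (PiE UNIV R \<inter> ({f. inner_w f f = 1} \<inter> {f. inner_w f (\<lambda>_. 1) = 0}))"
    by (intro compact_Int_closed closed_Int)
  also have "PiE UNIV R \<inter> ({f. inner_w f f = 1} \<inter> {f. inner_w f (\<lambda>_. 1) = 0}) = centred_sphere"
  proof -
    have "f \<eta> \<in> R \<eta>" if f: "f \<in> centred_sphere" for f \<eta>
    proof (cases "\<eta> \<in> X")
      case True
      have "w \<eta> * f \<eta> * f \<eta> \<le> inner_w f f"
        unfolding inner_w_def
        by (rule member_le_sum[OF True _ finite_states, of "\<lambda>\<eta>. w \<eta> * f \<eta> * f \<eta>"])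
           (simp add: weight_pos less_imp_le mult.assoc)
      then have "w \<eta> * (f \<eta>)\<^sup>2 \<le> 1"
        using f by (simp add: centred_sphere_def power2_eq_square mult.assoc)
      then have "(f \<eta>)\<^sup>2 \<le> 1 / w \<eta>" using weight_pos[OF True] by (simp add: field_simps)
      also have "\<dots> \<le> (1 + 1 / w \<eta>)\<^sup>2"
      proof -
        have "0 \<le> 1 / w \<eta>" using weight_pos[OF True] by simp
        moreover have "(1 + 1 / w \<eta>)\<^sup>2 = 1 + 2 * (1 / w \<eta>) + (1 / w \<eta>)\<^sup>2"
          by (simp add: power2_sum)
        ultimately show ?thesis using zero_le_power2[of "1 / w \<eta>"] by linarith
      qed
      finally have "\<bar>f \<eta>\<bar> \<le> 1 + 1 / w \<eta>"
        using weight_pos[OF True] by (simp add: abs_le_square_iff[symmetric])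
      then show ?thesis using True by (auto simp: R_def)
    next
      case False
      then show ?thesis using f by (simp add: centred_sphere_def R_def)
    qed
    moreover have "f \<eta> = 0" if "f \<in> PiE UNIV R" "\<eta> \<notin> X" for f \<eta>
      using that by (auto simp: PiE_def Pi_def R_def split: if_splits)
    ultimately show ?thesis unfolding centred_sphere_def by (fastforce simp: PiE_def Pi_def)
  qed
  finally show ?thesis .
qed

text \<open>Subtracting the mean turns the squared norm into the variance.\<close>

lemma centre:
  assumes "X \<noteq> {}"
  obtains c where "inner_w (\<lambda>\<eta>. f \<eta> - c) (\<lambda>_. 1) = 0"
    "inner_w (\<lambda>\<eta>. f \<eta> - c) (\<lambda>\<eta>. f \<eta> - c)
       = inner_w f f - (inner_w f (\<lambda>_. 1))\<^sup>2 / inner_w (\<lambda>_. 1) (\<lambda>_. 1)"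
proof
  have pos: "inner_w (\<lambda>_. 1) (\<lambda>_. 1) > 0" using assms by (intro inner_pos) auto
  define c where "c = inner_w f (\<lambda>_. 1) / inner_w (\<lambda>_. 1) (\<lambda>_. 1)"
  show 1: "inner_w (\<lambda>\<eta>. f \<eta> - c) (\<lambda>_. 1) = 0"
    using inner_lin[of "\<lambda>_. 1" f "- c" "\<lambda>_. 1"] pos
    by (subst inner_commute) (simp add: inner_commute[of f "\<lambda>_. 1"] c_def)
  have "inner_w (\<lambda>\<eta>. f \<eta> - c) (\<lambda>\<eta>. f \<eta> - c) = inner_w (\<lambda>\<eta>. f \<eta> - c) f"
    using inner_lin[of "\<lambda>\<eta>. f \<eta> - c" f "- c" "\<lambda>_. 1"] 1 by simp
  also have "\<dots> = inner_w f f - c * inner_w f (\<lambda>_. 1)"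
    using inner_lin[of f f "- c" "\<lambda>_. 1"] by (simp add: inner_commute[of "\<lambda>\<eta>. f \<eta> - c" f])
  finally show "inner_w (\<lambda>\<eta>. f \<eta> - c) (\<lambda>\<eta>. f \<eta> - c)
       = inner_w f f - (inner_w f (\<lambda>_. 1))\<^sup>2 / inner_w (\<lambda>_. 1) (\<lambda>_. 1)"
    by (simp add: c_def power2_eq_square)
qed

text \<open>The energy attains its minimum \<open>l\<close> on the sphere at some \<open>u\<close>. Varying \<open>u\<close> in the direction of the
residual \<open>r = A u - l u\<close>, which again has mean zero, the quadratic polynomial \<open>2 t \<langle>r, r\<rangle> + O(t\<^sup>2)\<close> is
nonnegative for all \<open>t\<close>. Hence \<open>\<langle>r, r\<rangle> = 0\<close> and \<open>u\<close> is an eigenfunction.\<close>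

lemma ex_minimal_eigenvalue:
  assumes nontrivial: "\<exists>\<eta>\<in>X. h \<eta> \<noteq> 0" "inner_w h (\<lambda>_. 1) = 0"
  obtains l u where "inner_w u u = 1" "inner_w u (\<lambda>_. 1) = 0" "\<forall>\<eta>\<in>X. A u \<eta> = l * u \<eta>"
    "\<And>f. inner_w f (\<lambda>_. 1) = 0 \<Longrightarrow> l * inner_w f f \<le> energy f f"
proof -
  define N where "N = (\<lambda>f \<eta>. if \<eta> \<in> X then f \<eta> / sqrt (inner_w f f) else 0)"
  have inner_N: "inner_w (N f) g = inner_w f g / sqrt (inner_w f f)" for f g
    by (simp add: inner_w_def N_def sum_divide_distrib cong: sum.cong)
  then have inner_N': "inner_w g (N f) = inner_w g f / sqrt (inner_w f f)" for f g
    by (metis inner_commute)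
  have energy_N: "energy (N f) g = energy f g / sqrt (inner_w f f)" for f g
    using inner_N[of f "A g"] by (simp add: inner_A)
  then have energy_N': "energy g (N f) = energy g f / sqrt (inner_w f f)" for f g
    by (metis energy_commute)
  have N_sphere: "N f \<in> centred_sphere" if "\<exists>\<eta>\<in>X. f \<eta> \<noteq> 0" "inner_w f (\<lambda>_. 1) = 0" for f
  proof -
    have "inner_w (N f) (N f) = 1"
      using inner_pos[OF that(1)] by (simp add: inner_N inner_N')
    then show ?thesis using that by (simp add: centred_sphere_def inner_N) (simp add: N_def)
  qed
  have "continuous_on centred_sphere (\<lambda>f. energy f f)"
    unfolding energy_def
    by (intro continuous_intros continuous_on_subset[OF continuous_on_product_coordinates]) auto
  then obtain u where u: "u \<in> centred_sphere"
      "\<And>f. f \<in> centred_sphere \<Longrightarrow> energy u u \<le> energy f f"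
    using continuous_attains_inf[OF compact_centred_sphere] N_sphere[OF nontrivial] by blast
  define l where "l = energy u u"
  have min: "l * inner_w f f \<le> energy f f" if "inner_w f (\<lambda>_. 1) = 0" for f
  proof (cases "\<exists>\<eta>\<in>X. f \<eta> \<noteq> 0")
    case True
    have "l \<le> energy (N f) (N f)" unfolding l_def by (rule u(2)[OF N_sphere[OF True that]])
    also have "\<dots> = energy f f / inner_w f f"
      using inner_pos[OF True] by (simp add: energy_N energy_N')
    finally show ?thesis using inner_pos[OF True] by (simp add: field_simps)
  next
    case False
    then show ?thesis using inner_eq_0_iff[of f] energy_nonneg[of f] by auto
  qed
  have u1: "inner_w u u = 1" and u0: "inner_w u (\<lambda>_. 1) = 0"
    using u(1) by (auto simp: centred_sphere_def)
  define r where "r = (\<lambda>\<eta>. A u \<eta> + (- l) * u \<eta>)"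
  have r: "inner_w f r = energy f u - l * inner_w f u" for f
    unfolding r_def inner_lin by (simp add: inner_A)
  have r0: "inner_w r (\<lambda>_. 1) = 0"
    using r[of "\<lambda>_. 1"] u0 energy_const[of u 1]
    by (simp add: energy_commute[of u "\<lambda>_. 1"] inner_commute[of u "\<lambda>_. 1"] inner_commute[of r "\<lambda>_. 1"])
  define a where "a = inner_w r r"
  define b where "b = energy r r - l * a"
  have b: "b \<ge> 0" using min[OF r0] by (simp add: b_def a_def)
  have quad: "2 * t * a + t\<^sup>2 * b \<ge> 0" for t
  proof -
    let ?f = "\<lambda>\<eta>. u \<eta> + t * r \<eta>"
    have f0: "inner_w ?f (\<lambda>_. 1) = 0"
      using u0 r0 by (metis (no_types) inner_commute inner_lin add_0 mult_zero_right)
    have i: "inner_w ?f ?f = 1 + 2 * t * inner_w r u + t\<^sup>2 * a"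
      using inner_lin[of ?f u t r] inner_lin[of u u t r] inner_lin[of r u t r]
      by (simp add: u1 a_def inner_commute[of ?f u] inner_commute[of ?f r] inner_commute[of u r]
          power2_eq_square algebra_simps)
    have e: "energy ?f ?f = l + 2 * t * energy r u + t\<^sup>2 * energy r r"
      using energy_lin[of ?f u t r] energy_lin[of u u t r] energy_lin[of r u t r]
      by (simp add: l_def energy_commute[of ?f u] energy_commute[of ?f r] energy_commute[of u r]
          power2_eq_square algebra_simps)
    have ru: "energy r u = a + l * inner_w r u" using r[of r] by (simp add: a_def)
    show ?thesis
      using min[OF f0] ru unfolding i e b_def by (simp add: algebra_simps)
  qed
  have "a = 0"
  proof (rule ccontr)
    assume "a \<noteq> 0"
    then have a: "a > 0" using inner_nonneg[of r] by (simp add: a_def)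
    define t where "t = 1 / (b + 1)"
    have t: "t > 0" "t * b < 1" using b by (simp_all add: t_def)
    have "2 * (- (a * t)) * a + (- (a * t))\<^sup>2 * b = - (a * a * t * (2 - t * b))"
      by (simp add: power2_eq_square algebra_simps)
    moreover have "a * a * t * (2 - t * b) > 0" using a t by (intro mult_pos_pos) auto
    ultimately show False using quad[of "- (a * t)"] by linarith
  qed
  then have "\<forall>\<eta>\<in>X. A u \<eta> = l * u \<eta>"
    using inner_eq_0_iff[of r] by (simp add: a_def r_def)
  then show thesis using that u1 u0 min by blast
qed

text \<open>Eigenfunctions of nonzero eigenvalues have mean zero, so a Poincare inequality bounds these
eigenvalues from below; the minimal Rayleigh quotient is itself such an eigenvalue, so every
function gives an upper bound. The Poincare inequality also ensures that the eigenvalue \<open>0\<close>, which is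
removed from the spectrum here, does not occur on functions of mean zero.\<close>

lemma second_eigenvalue:
  assumes poincare: "K > 0" "\<And>f. inner_w f (\<lambda>_. 1) = 0 \<Longrightarrow> K * inner_w f f \<le> energy f f"
    and two: "\<xi> \<in> X" "\<xi>' \<in> X" "\<xi> \<noteq> \<xi>'"
  defines "\<gamma> \<equiv> Min (spectrum - {Min spectrum})"
  shows "K \<le> \<gamma>"
    and "\<gamma> * (inner_w f f - (inner_w f (\<lambda>_. 1))\<^sup>2 / inner_w (\<lambda>_. 1) (\<lambda>_. 1)) \<le> energy f f"
proof -
  have X: "X \<noteq> {}" using two by auto
  have \<gamma>: "\<gamma> = Min (spectrum - {0})" by (simp add: \<gamma>_def Min_spectrum[OF X])
  have lower: "K \<le> l" if l: "l \<in> spectrum" "l \<noteq> 0" for l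
  proof -
    obtain f where f: "\<exists>\<eta>\<in>X. f \<eta> \<noteq> 0" "\<forall>\<eta>\<in>X. A f \<eta> = l * f \<eta>"
      using l unfolding spectrum_def by blast
    have "l * inner_w f (\<lambda>_. 1) = 0"
      using eigen_energy[OF f(2), of "\<lambda>_. 1"] energy_const[of f 1]
      by (simp add: energy_commute[of f "\<lambda>_. 1"] inner_commute[of f "\<lambda>_. 1"])
    then have "K * inner_w f f \<le> l * inner_w f f"
      using poincare(2)[of f] l(2) eigen_energy[OF f(2), of f] by simp
    then show ?thesis using inner_pos[OF f(1)] by simp
  qed
  define i where "i = (\<lambda>\<eta>. if \<eta> = \<xi> then 1 else (0::real))"
  obtain c0 where c0: "inner_w (\<lambda>\<eta>. i \<eta> - c0) (\<lambda>_. 1) = 0" using centre[OF X] by metis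
  have "i \<xi> - c0 \<noteq> 0 \<or> i \<xi>' - c0 \<noteq> 0" using two(3) by (auto simp: i_def)
  then have "\<exists>\<eta>\<in>X. i \<eta> - c0 \<noteq> 0" using two(1,2) by auto
  from ex_minimal_eigenvalue[OF this c0] obtain l u where
      u: "inner_w u u = 1" "inner_w u (\<lambda>_. 1) = 0" "\<forall>\<eta>\<in>X. A u \<eta> = l * u \<eta>"
      and min: "\<And>f. inner_w f (\<lambda>_. 1) = 0 \<Longrightarrow> l * inner_w f f \<le> energy f f"
    by metis
  have "K \<le> l" using poincare(2)[OF u(2)] eigen_energy[OF u(3), of u] u(1) by simp
  then have "l \<noteq> 0" using poincare(1) by simp
  have "\<exists>\<eta>\<in>X. u \<eta> \<noteq> 0" using u(1) inner_eq_0_iff[of u] by auto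
  then have l: "l \<in> spectrum - {0}" using u(3) \<open>l \<noteq> 0\<close> unfolding spectrum_def by blast
  then show "K \<le> \<gamma>" unfolding \<gamma> using finite_spectrum lower by (subst Min_ge_iff) auto
  have "\<gamma> \<le> l" unfolding \<gamma> using l finite_spectrum by (intro Min_le) auto
  obtain c where c: "inner_w (\<lambda>\<eta>. f \<eta> - c) (\<lambda>_. 1) = 0"
      "inner_w (\<lambda>\<eta>. f \<eta> - c) (\<lambda>\<eta>. f \<eta> - c)
       = inner_w f f - (inner_w f (\<lambda>_. 1))\<^sup>2 / inner_w (\<lambda>_. 1) (\<lambda>_. 1)" (is "?v = _")
    using centre[OF X] by metis
  have "\<gamma> * ?v \<le> l * ?v" using \<open>\<gamma> \<le> l\<close> inner_nonneg by (intro mult_right_mono)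
  also have "\<dots> \<le> energy f f" using min[OF c(1)] by (simp add: energy_shift)
  finally show "\<gamma> * (inner_w f f - (inner_w f (\<lambda>_. 1))\<^sup>2 / inner_w (\<lambda>_. 1) (\<lambda>_. 1)) \<le> energy f f"
    by (simp add: c(2))
qed

end

section \<open>Inclusion processes with one and two particles\<close>

lemma sum_over_fibres:
  fixes m :: "'i \<Rightarrow> real"
  assumes "finite I"
  shows "(\<Sum>\<eta>\<in>p ` I. (\<Sum>i\<in>{i\<in>I. p i = \<eta>}. m i) * \<phi> \<eta>) = (\<Sum>i\<in>I. m i * \<phi> (p i))"
  unfolding sum.image_gen[OF assms, of "\<lambda>i. m i * \<phi> (p i)" p]
  by (intro sum.cong refl) (simp add: sum_distrib_right)

definition one_particle :: "'v \<Rightarrow> 'v \<Rightarrow> nat" where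
  "one_particle x = (\<lambda>z. of_bool (z = x))"

definition two_particles :: "'v \<Rightarrow> 'v \<Rightarrow> 'v \<Rightarrow> nat" where
  "two_particles x y = (\<lambda>z. of_bool (z = x) + of_bool (z = y))"

lemma two_particles_commute: "two_particles x y = two_particles y x"
  by (simp add: two_particles_def add.commute)

lemma move_one_particle: "move (one_particle x) x v = one_particle v"
  by (auto simp: move_def one_particle_def fun_eq_iff)

lemma move_two_particles:
  "move (two_particles x y) x v = two_particles v y"
  "move (two_particles x y) y v = two_particles x v"
  by (auto simp: move_def two_particles_def fun_eq_iff)

lemma configs_1:
  assumes "finite V"
  shows "configs V 1 = one_particle ` V"
proof (intro equalityI subsetI)
  fix \<eta> assume "\<eta> \<in> configs V 1"
  then have out: "\<And>z. z \<notin> V \<Longrightarrow> \<eta> z = 0" and "(\<Sum>z\<in>V. \<eta> z) = Suc 0"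
    by (auto simp: configs_def)
  then obtain x where x: "x \<in> V" "\<eta> x = Suc 0" "\<forall>y\<in>V. x \<noteq> y \<longrightarrow> \<eta> y = 0"
    using sum_eq_Suc0_iff[OF assms, of \<eta>] by blast
  then have "\<eta> = one_particle x" using out by (force simp: one_particle_def fun_eq_iff)
  then show "\<eta> \<in> one_particle ` V" using x(1) by blast
next
  fix \<eta> assume "\<eta> \<in> one_particle ` V"
  then show "\<eta> \<in> configs V 1"
    using assms by (auto simp: configs_def one_particle_def of_bool_def)
qed

text \<open>Removing a particle reduces to the case of a single one.\<close>

lemma configs_2:
  assumes "finite V"
  shows "configs V 2 = (\<lambda>(x, y). two_particles x y) ` (V \<times> V)"
proof (intro equalityI subsetI)
  fix \<eta> assume "\<eta> \<in> configs V 2"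
  then have out: "\<And>z. z \<notin> V \<Longrightarrow> \<eta> z = 0" and sum: "(\<Sum>z\<in>V. \<eta> z) = 2"
    by (auto simp: configs_def)
  then obtain x where x: "x \<in> V" "\<eta> x > 0" by (metis bot_nat_0.not_eq_extremum sum.neutral zero_neq_numeral)
  define \<xi> where "\<xi> = (\<lambda>z. \<eta> z - of_bool (z = x))"
  have \<eta>: "\<eta> z = \<xi> z + of_bool (z = x)" for z using x by (auto simp: \<xi>_def)
  have "(\<Sum>z\<in>V. \<xi> z) + 1 = 2"
    using sum x(1) assms unfolding \<eta> by (simp add: sum.distrib of_bool_def)
  then have "\<xi> \<in> configs V 1" using out by (simp add: configs_def \<xi>_def)
  then obtain y where "y \<in> V" "\<xi> = one_particle y" using configs_1[OF assms] by auto
  then have "\<eta> = two_particles x y"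
    using \<eta> by (auto simp: one_particle_def two_particles_def fun_eq_iff)
  then show "\<eta> \<in> (\<lambda>(x, y). two_particles x y) ` (V \<times> V)" using x(1) \<open>y \<in> V\<close> by auto
next
  fix \<eta> assume "\<eta> \<in> (\<lambda>(x, y). two_particles x y) ` (V \<times> V)"
  then show "\<eta> \<in> configs V 2"
    using assms by (auto simp: configs_def two_particles_def of_bool_def sum.distrib)
qed

lemma sip_gen_one_particle:
  assumes "finite V" "x \<in> V" "c x x = 0"
  shows "sip_gen V c \<alpha> f (one_particle x)
       = (\<Sum>v\<in>V. c x v * \<alpha> v * (f (one_particle v) - f (one_particle x)))"
proof -
  have "sip_gen V c \<alpha> f (one_particle x)
      = (\<Sum>u\<in>V. if u = x then (\<Sum>v\<in>V. c x v * (\<alpha> v + of_bool (v = x))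
          * (f (one_particle v) - f (one_particle x))) else 0)"
    unfolding sip_gen_def
    by (intro sum.cong refl) (auto simp: move_one_particle, auto simp: one_particle_def)
  also have "\<dots> = (\<Sum>v\<in>V. c x v * (\<alpha> v + of_bool (v = x))
          * (f (one_particle v) - f (one_particle x)))"
    using assms by simp
  also have "\<dots> = (\<Sum>v\<in>V. c x v * \<alpha> v * (f (one_particle v) - f (one_particle x)))"
    using assms(3) by (intro sum.cong refl) auto
  finally show ?thesis .
qed

text \<open>Each of the two labelled particles jumps on its own; the other one is felt only through the extra
rate of jumping onto its site. Since there are no loops, this formula also covers two
particles on the same site.\<close>

lemma sip_gen_two_particles:
  assumes "finite V" "x \<in> V" "y \<in> V" "c x x = 0" "c y y = 0"
  shows "sip_gen V c \<alpha> f (two_particles x y)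
       = (\<Sum>v\<in>V. c x v * (\<alpha> v + of_bool (v = y)) * (f (two_particles v y) - f (two_particles x y)))
       + (\<Sum>v\<in>V. c y v * (\<alpha> v + of_bool (v = x)) * (f (two_particles x v) - f (two_particles x y)))"
proof -
  let ?r = "\<lambda>u v. c u v * (\<alpha> v + of_bool (v = x) + of_bool (v = y))
                 * (f (move (two_particles x y) u v) - f (two_particles x y))"
  have "sip_gen V c \<alpha> f (two_particles x y)
      = (\<Sum>u\<in>V. (if u = x then \<Sum>v\<in>V. ?r x v else 0) + (if u = y then \<Sum>v\<in>V. ?r y v else 0))"
    unfolding sip_gen_def
    by (intro sum.cong refl) (auto simp: two_particles_def sum_distrib_left algebra_simps simp flip: sum.distrib)
  also have "\<dots> = (\<Sum>v\<in>V. ?r x v) + (\<Sum>v\<in>V. ?r y v)"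
    using assms by (simp add: sum.distrib)
  also have "(\<Sum>v\<in>V. ?r x v)
      = (\<Sum>v\<in>V. c x v * (\<alpha> v + of_bool (v = y)) * (f (two_particles v y) - f (two_particles x y)))"
    using assms(4) by (intro sum.cong refl) (auto simp: move_two_particles)
  also have "(\<Sum>v\<in>V. ?r y v)
      = (\<Sum>v\<in>V. c y v * (\<alpha> v + of_bool (v = x)) * (f (two_particles x v) - f (two_particles x y)))"
    using assms(5) by (intro sum.cong refl) (auto simp: move_two_particles)
  finally show ?thesis .
qed

text \<open>Discrete Green formula: average the left-hand side with its copy in which \<open>x\<close> and \<open>v\<close> are
exchanged.\<close>

lemma sum_by_parts:
  fixes K :: "'v \<Rightarrow> 'v \<Rightarrow> real"
  assumes "\<And>x v. x \<in> V \<Longrightarrow> v \<in> V \<Longrightarrow> K x v = K v x"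
  shows "2 * (\<Sum>x\<in>V. \<Sum>v\<in>V. K x v * f x * (g x - g v))
       = (\<Sum>x\<in>V. \<Sum>v\<in>V. K x v * (f x - f v) * (g x - g v))"
proof -
  have "(\<Sum>x\<in>V. \<Sum>v\<in>V. K x v * f x * (g x - g v)) = (\<Sum>x\<in>V. \<Sum>v\<in>V. K x v * f v * (g v - g x))"
    by (subst sum.swap, intro sum.cong refl) (simp add: assms)
  then have "2 * (\<Sum>x\<in>V. \<Sum>v\<in>V. K x v * f x * (g x - g v))
     = (\<Sum>x\<in>V. \<Sum>v\<in>V. K x v * f x * (g x - g v)) + (\<Sum>x\<in>V. \<Sum>v\<in>V. K x v * f v * (g v - g x))"
    by simp
  also have "\<dots> = (\<Sum>x\<in>V. \<Sum>v\<in>V. K x v * (f x - f v) * (g x - g v))"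
    unfolding sum.distrib[symmetric] by (intro sum.cong refl) (simp add: algebra_simps)
  finally show ?thesis .
qed

locale conductance_graph =
  fixes V :: "'v set" and c :: "'v \<Rightarrow> 'v \<Rightarrow> real"
  assumes graph: "weighted_graph V c"
begin

lemma finite_V: "finite V" and sym: "x \<in> V \<Longrightarrow> y \<in> V \<Longrightarrow> c x y = c y x"
  and cond_nonneg: "x \<in> V \<Longrightarrow> y \<in> V \<Longrightarrow> c x y \<ge> 0" and loop_free: "x \<in> V \<Longrightarrow> c x x = 0"
  using graph by (auto simp: weighted_graph_def)

end

locale sip = conductance_graph V c
  for V :: "'v set" and c :: "'v \<Rightarrow> 'v \<Rightarrow> real" +
  fixes \<alpha> :: "'v \<Rightarrow> real"
  assumes site_pos: "x \<in> V \<Longrightarrow> \<alpha> x > 0"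
begin

text \<open>The reversible measures (up to a constant factor) are images of measures on labelled particles.
For two particles the labelled weight \<open>\<alpha> x * (\<alpha> y + of_bool (x = y))\<close> is symmetric in \<open>x\<close> and \<open>y\<close>:
a pair of distinct sites receives \<open>2 \<alpha>\<^sub>x \<alpha>\<^sub>y\<close> and a doubly occupied site \<open>\<alpha>\<^sub>x (\<alpha>\<^sub>x + 1)\<close>.\<close>

definition weight1 :: "('v \<Rightarrow> nat) \<Rightarrow> real" where
  "weight1 \<eta> = (\<Sum>x\<in>{x\<in>V. one_particle x = \<eta>}. \<alpha> x)"

definition weight2 :: "('v \<Rightarrow> nat) \<Rightarrow> real" where
  "weight2 \<eta> = (\<Sum>(x, y)\<in>{i\<in>V \<times> V. (\<lambda>(x, y). two_particles x y) i = \<eta>}. \<alpha> x * (\<alpha> y + of_bool (x = y)))"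

lemma sum_weight1:
  "(\<Sum>\<eta>\<in>configs V 1. weight1 \<eta> * \<phi> \<eta>) = (\<Sum>x\<in>V. \<alpha> x * \<phi> (one_particle x))"
  unfolding configs_1[OF finite_V] weight1_def by (rule sum_over_fibres[OF finite_V])

lemma sum_weight2:
  "(\<Sum>\<eta>\<in>configs V 2. weight2 \<eta> * \<phi> \<eta>)
     = (\<Sum>x\<in>V. \<Sum>y\<in>V. \<alpha> x * (\<alpha> y + of_bool (x = y)) * \<phi> (two_particles x y))"
proof -
  have "(\<Sum>\<eta>\<in>configs V 2. weight2 \<eta> * \<phi> \<eta>)
      = (\<Sum>i\<in>V \<times> V. (case i of (x, y) \<Rightarrow> \<alpha> x * (\<alpha> y + of_bool (x = y)))
          * \<phi> (case i of (x, y) \<Rightarrow> two_particles x y))"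
    unfolding configs_2[OF finite_V] weight2_def
    by (rule sum_over_fibres) (simp add: finite_V)
  also have "\<dots> = (\<Sum>(x, y)\<in>V \<times> V. \<alpha> x * (\<alpha> y + of_bool (x = y)) * \<phi> (two_particles x y))"
    by (intro sum.cong refl) auto
  finally show ?thesis by (simp add: sum.cartesian_product)
qed

lemma form1:
  "(\<Sum>x\<in>V. \<alpha> x * (f (one_particle x) * - sip_gen V c \<alpha> g (one_particle x)))
     = (\<Sum>x\<in>V. \<Sum>v\<in>V. c x v * \<alpha> x * \<alpha> v / 2 * (f (one_particle x) - f (one_particle v))
           * (g (one_particle x) - g (one_particle v)))"
proof -
  let ?K = "\<lambda>x v. c x v * \<alpha> x * \<alpha> v / 2"
  let ?f = "\<lambda>x. f (one_particle x)" and ?g = "\<lambda>x. g (one_particle x)"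
  have "(\<Sum>x\<in>V. \<alpha> x * (?f x * - sip_gen V c \<alpha> g (one_particle x)))
      = 2 * (\<Sum>x\<in>V. \<Sum>v\<in>V. ?K x v * ?f x * (?g x - ?g v))"
    unfolding sum_distrib_left
  proof (intro sum.cong refl)
    fix x assume "x \<in> V"
    then show "\<alpha> x * (?f x * - sip_gen V c \<alpha> g (one_particle x))
        = (\<Sum>v\<in>V. 2 * (?K x v * ?f x * (?g x - ?g v)))"
      unfolding sip_gen_one_particle[of V x c, OF finite_V \<open>x \<in> V\<close> loop_free[OF \<open>x \<in> V\<close>], of \<alpha> g]
        sum_negf[symmetric] sum_distrib_left
      by (intro sum.cong refl) (simp add: algebra_simps)
  qed
  also have "\<dots> = (\<Sum>x\<in>V. \<Sum>v\<in>V. ?K x v * (?f x - ?f v) * (?g x - ?g v))"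
    by (rule sum_by_parts) (simp add: sym mult_ac)
  finally show ?thesis .
qed

text \<open>Weight of the labelled state \<open>(x, y)\<close> times the rate of its jump to \<open>(v, y)\<close>; for fixed \<open>y\<close> it is the
conductance of a walk with site weights \<open>\<alpha> + \<delta>\<^sub>y\<close>, symmetric in \<open>x\<close> and \<open>v\<close>.\<close>

definition rate2 :: "'v \<Rightarrow> 'v \<Rightarrow> 'v \<Rightarrow> real" where
  "rate2 x v y = c x v * \<alpha> y * (\<alpha> x + of_bool (x = y)) * (\<alpha> v + of_bool (v = y))"

text \<open>By symmetry both particles contribute the same amount. This factor \<open>2\<close> cancels the factor \<open>1/2\<close> of the
Green formula, applied in the first particle with the second one fixed.\<close>

lemma form2:
  "(\<Sum>x\<in>V. \<Sum>y\<in>V. \<alpha> x * (\<alpha> y + of_bool (x = y))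
        * (f (two_particles x y) * - sip_gen V c \<alpha> g (two_particles x y)))
     = (\<Sum>x\<in>V. \<Sum>v\<in>V. \<Sum>y\<in>V. rate2 x v y * (f (two_particles x y) - f (two_particles v y))
           * (g (two_particles x y) - g (two_particles v y)))" (is "?L = ?R")
proof -
  let ?f = "\<lambda>x y. f (two_particles x y)" and ?g = "\<lambda>x y. g (two_particles x y)"
  define T where "T = (\<lambda>x y. \<Sum>v\<in>V. rate2 x v y * ?f x y * (?g x y - ?g v y))"
  have "\<alpha> x * (\<alpha> y + of_bool (x = y)) * (?f x y * - sip_gen V c \<alpha> g (two_particles x y))
      = T x y + T y x" if "x \<in> V" "y \<in> V" for x y
  proof -
    have "T x y = \<alpha> x * (\<alpha> y + of_bool (x = y)) * ?f x y
        * - (\<Sum>v\<in>V. c x v * (\<alpha> v + of_bool (v = y)) * (?g v y - ?g x y))"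
      unfolding T_def sum_negf[symmetric] sum_distrib_left
      by (intro sum.cong refl) (auto simp: rate2_def algebra_simps)
    moreover have "T y x = \<alpha> x * (\<alpha> y + of_bool (x = y)) * ?f x y
        * - (\<Sum>v\<in>V. c y v * (\<alpha> v + of_bool (v = x)) * (?g x v - ?g x y))"
      unfolding T_def sum_negf[symmetric] sum_distrib_left
      by (intro sum.cong refl)
         (auto simp: rate2_def two_particles_commute[of _ x] algebra_simps)
    ultimately show ?thesis
      using that by (simp add: sip_gen_two_particles finite_V loop_free algebra_simps)
  qed
  then have "?L = (\<Sum>x\<in>V. \<Sum>y\<in>V. T x y + T y x)" by simp
  also have "\<dots> = 2 * (\<Sum>x\<in>V. \<Sum>y\<in>V. T x y)"
    by (simp add: sum.distrib) (rule sum.swap)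
  also have "(\<Sum>x\<in>V. \<Sum>y\<in>V. T x y) = (\<Sum>y\<in>V. \<Sum>x\<in>V. \<Sum>v\<in>V. rate2 x v y * ?f x y * (?g x y - ?g v y))"
    unfolding T_def by (rule sum.swap)
  also have "2 * \<dots> = (\<Sum>y\<in>V. \<Sum>x\<in>V. \<Sum>v\<in>V. rate2 x v y * (?f x y - ?f v y) * (?g x y - ?g v y))"
  proof (subst sum_distrib_left, intro sum.cong refl)
    fix y
    show "2 * (\<Sum>x\<in>V. \<Sum>v\<in>V. rate2 x v y * ?f x y * (?g x y - ?g v y))
        = (\<Sum>x\<in>V. \<Sum>v\<in>V. rate2 x v y * (?f x y - ?f v y) * (?g x y - ?g v y))"
      by (rule sum_by_parts) (simp add: rate2_def sym mult_ac)
  qed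
  also have "\<dots> = (\<Sum>x\<in>V. \<Sum>y\<in>V. \<Sum>v\<in>V. rate2 x v y * (?f x y - ?f v y) * (?g x y - ?g v y))"
    by (rule sum.swap)
  also have "\<dots> = ?R" by (rule sum.cong[OF refl], rule sum.swap)
  finally show ?thesis .
qed

sublocale one: reversible_operator "configs V 1" weight1 "\<lambda>f \<eta>. - sip_gen V c \<alpha> f \<eta>"
  "V \<times> V" "\<lambda>(x, v). c x v * \<alpha> x * \<alpha> v / 2" "\<lambda>(x, v). one_particle x" "\<lambda>(x, v). one_particle v"
proof
  show "finite (configs V 1)" unfolding configs_1[OF finite_V] by (simp add: finite_V)
  show "0 < weight1 \<eta>" if "\<eta> \<in> configs V 1" for \<eta>
    using that site_pos unfolding weight1_def configs_1[OF finite_V]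
    by (intro sum_pos) (auto simp: finite_V)
  show "0 \<le> (case j of (x, v) \<Rightarrow> c x v * \<alpha> x * \<alpha> v / 2)" if "j \<in> V \<times> V" for j
    using that by (auto simp: cond_nonneg site_pos less_imp_le)
  show "(\<Sum>\<eta>\<in>configs V 1. weight1 \<eta> * f \<eta> * - sip_gen V c \<alpha> g \<eta>) =
       (\<Sum>j\<in>V \<times> V. (case j of (x, v) \<Rightarrow> c x v * \<alpha> x * \<alpha> v / 2)
          * (f (case j of (x, v) \<Rightarrow> one_particle x) - f (case j of (x, v) \<Rightarrow> one_particle v))
          * (g (case j of (x, v) \<Rightarrow> one_particle x) - g (case j of (x, v) \<Rightarrow> one_particle v)))" for f g
    unfolding mult.assoc[of "weight1 _"] sum_weight1 form1
    by (simp add: sum.cartesian_product split_def)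
qed

sublocale two: reversible_operator "configs V 2" weight2 "\<lambda>f \<eta>. - sip_gen V c \<alpha> f \<eta>"
  "V \<times> V \<times> V" "\<lambda>(x, v, y). rate2 x v y"
  "\<lambda>(x, v, y). two_particles x y" "\<lambda>(x, v, y). two_particles v y"
proof
  show "finite (configs V 2)" by (simp add: configs_2 finite_V)
  show "0 < weight2 \<eta>" if "\<eta> \<in> configs V 2" for \<eta>
    unfolding weight2_def using that site_pos
    by (intro sum_pos) (auto simp: configs_2 finite_V add_pos_nonneg)
  show "0 \<le> (case j of (x, v, y) \<Rightarrow> rate2 x v y)" if "j \<in> V \<times> V \<times> V" for j
    using that by (auto simp: rate2_def cond_nonneg site_pos less_imp_le)
  show "(\<Sum>\<eta>\<in>configs V 2. weight2 \<eta> * f \<eta> * - sip_gen V c \<alpha> g \<eta>) =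
       (\<Sum>j\<in>V \<times> V \<times> V. (case j of (x, v, y) \<Rightarrow> rate2 x v y)
          * (f (case j of (x, v, y) \<Rightarrow> two_particles x y) - f (case j of (x, v, y) \<Rightarrow> two_particles v y))
          * (g (case j of (x, v, y) \<Rightarrow> two_particles x y) - g (case j of (x, v, y) \<Rightarrow> two_particles v y)))" for f g
    unfolding mult.assoc[of "weight2 _"] sum_weight2 form2
    by (simp add: sum.cartesian_product split_def)
qed

lemma gap_spectrum:
  "gap V c \<alpha> 1 = Min (one.spectrum - {Min one.spectrum})"
  "gap V c \<alpha> 2 = Min (two.spectrum - {Min two.spectrum})"
  unfolding gap_def sip_eigenvalues_def one.spectrum_def two.spectrum_def by (rule refl)+

lemma inner1: "one.inner_w f g = (\<Sum>x\<in>V. \<alpha> x * (f (one_particle x) * g (one_particle x)))"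
  unfolding one.inner_w_def mult.assoc[of "weight1 _"] by (rule sum_weight1)

lemma inner2: "two.inner_w f g
    = (\<Sum>x\<in>V. \<Sum>y\<in>V. \<alpha> x * (\<alpha> y + of_bool (x = y)) * (f (two_particles x y) * g (two_particles x y)))"
  unfolding two.inner_w_def mult.assoc[of "weight2 _"] by (rule sum_weight2)

lemma energy1: "one.energy f g
    = (\<Sum>x\<in>V. \<Sum>v\<in>V. c x v * \<alpha> x * \<alpha> v / 2 * (f (one_particle x) - f (one_particle v))
           * (g (one_particle x) - g (one_particle v)))"
  unfolding one.energy_def by (simp add: sum.cartesian_product split_def)

lemma energy2: "two.energy f g
    = (\<Sum>x\<in>V. \<Sum>v\<in>V. \<Sum>y\<in>V. rate2 x v y * (f (two_particles x y) - f (two_particles v y))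
           * (g (two_particles x y) - g (two_particles v y)))"
  unfolding two.energy_def by (simp add: sum.cartesian_product split_def)

end

section \<open>Graphs with constant codegree\<close>

lemma two_particles_eq_iff:
  "two_particles x y = two_particles x' y' \<longleftrightarrow> x = x' \<and> y = y' \<or> x = y' \<and> y = x'"
proof
  assume "two_particles x y = two_particles x' y'"
  then have "{z. two_particles x y z > 0} = {z. two_particles x' y' z > 0}" by simp
  moreover have "{z. two_particles a b z > 0} = {a, b}" for a b :: 'a
    by (auto simp: two_particles_def)
  ultimately show "x = x' \<and> y = y' \<or> x = y' \<and> y = x'" by (simp add: doubleton_eq_iff)
qed (metis two_particles_commute)

text \<open>Symmetric functions of two labelled particles are functions of the configuration.\<close>

lemma lift_to_two_particles:
  fixes F :: "'a \<Rightarrow> 'a \<Rightarrow> real"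
  assumes "\<And>x y. F x y = F y x"
  obtains f where "\<And>x y. f (two_particles x y) = F x y"
proof
  fix x y :: 'a
  define i where "i = (SOME i. two_particles x y = two_particles (fst i) (snd i))"
  have "two_particles x y = two_particles (fst i) (snd i)"
    unfolding i_def by (rule someI[of _ "(x, y)"]) simp
  then have "F (fst i) (snd i) = F x y"
    unfolding two_particles_eq_iff using assms[of x y] by auto
  then show "(\<lambda>\<eta>. let i = (SOME i. \<eta> = two_particles (fst i) (snd i)) in F (fst i) (snd i))
      (two_particles x y) = F x y"
    by (simp add: i_def Let_def)
qed

text \<open>Simple graphs in which any two distinct non-adjacent sites have \<open>\<mu>\<close> common neighbours and whose
walk with unit site weights has spectral gap \<open>g > 2\<mu>\<close>. The gap is described by the optimal constant in
the Poincare inequality; the factors \<open>2\<close> are there because the double sums visit every edge twice.\<close>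

locale codegree_graph = conductance_graph V c
  for V :: "'v set" and c :: "'v \<Rightarrow> 'v \<Rightarrow> real" +
  fixes \<mu> g :: real
  assumes unit_conductance: "x \<in> V \<Longrightarrow> y \<in> V \<Longrightarrow> c x y = 0 \<or> c x y = 1"
    and codegree: "x \<in> V \<Longrightarrow> y \<in> V \<Longrightarrow> x \<noteq> y \<Longrightarrow> c x y = 0 \<Longrightarrow> (\<Sum>z\<in>V. c x z * c z y) = \<mu>"
    and not_complete: "\<exists>x\<in>V. \<exists>y\<in>V. x \<noteq> y \<and> c x y = 0"
    and poincare: "(\<Sum>x\<in>V. h x) = 0 \<Longrightarrow>
        2 * g * (\<Sum>x\<in>V. (h x)\<^sup>2) \<le> (\<Sum>x\<in>V. \<Sum>y\<in>V. c x y * (h x - h y)\<^sup>2)"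
    and poincare_sharp: "\<exists>h. (\<Sum>x\<in>V. h x) = 0 \<and> (\<exists>x\<in>V. h x \<noteq> 0) \<and>
        (\<Sum>x\<in>V. \<Sum>y\<in>V. c x y * (h x - h y)\<^sup>2) = 2 * g * (\<Sum>x\<in>V. (h x)\<^sup>2)"
    and codegree_pos: "\<mu> > 0" and codegree_small: "2 * \<mu> < g"
begin

definition nonadj :: "'v \<Rightarrow> 'v \<Rightarrow> real" where
  "nonadj x y = of_bool (x \<in> V \<and> y \<in> V \<and> x \<noteq> y \<and> c x y = 0)"

lemma nonadj_commute: "nonadj x y = nonadj y x"
proof -
  have "x \<in> V \<and> y \<in> V \<and> x \<noteq> y \<and> c x y = 0 \<longleftrightarrow> y \<in> V \<and> x \<in> V \<and> y \<noteq> x \<and> c y x = 0"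
    using sym[of x y] by auto
  then show ?thesis by (simp only: nonadj_def)
qed

lemma nonadj_eq: "x \<in> V \<Longrightarrow> y \<in> V \<Longrightarrow> nonadj x y = 1 - c x y - of_bool (x = y)"
  using unit_conductance[of x y] by (auto simp: nonadj_def loop_free)

lemma nonadj_bounds: "0 \<le> nonadj x y" "nonadj x y \<le> 1"
  by (auto simp: nonadj_def)

lemma g_pos: "g > 0" using codegree_pos codegree_small by linarith

lemma degree_le: "x \<in> V \<Longrightarrow> (\<Sum>y\<in>V. c x y) \<le> card V"
proof -
  assume x: "x \<in> V"
  have "c x y \<le> 1" if "y \<in> V" for y using unit_conductance[OF x that] by auto
  then show ?thesis using sum_bounded_above[of V "c x" 1] by simp
qed

text \<open>Up to the factor \<open>1 - \<delta>\<close>, nothing relaxes more slowly than the killed walk of separated pairs. The proof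
splits \<open>S\<close> into the contributions \<open>N\<close> of separated pairs, \<open>W\<close> of edges and \<open>T\<close> of the
diagonal. The Poincare inequality on the diagonal, with the value of \<open>F\<close> on an edge as
intermediary between the values at its endpoints, gives \<open>g T \<le> 2 Q\<close>, and then \<open>W \<le> C Q\<close> with a constant \<open>C\<close>.
Keeping only the jumps of \<open>P\<close> between separated pairs and edges gives
\<open>P \<ge> 2\<mu> (1 - \<delta>) N\<close> up to a multiple of \<open>W\<close>. All error terms carry a factor \<open>\<epsilon>\<close> and are absorbed by the
part of \<open>2 Q\<close> that \<open>2\<mu> < g\<close> leaves over after paying for \<open>T\<close>.\<close>

lemma slow_energy_lower_bound:
  fixes F :: "'v \<Rightarrow> 'v \<Rightarrow> real"
  assumes F: "\<And>x y. F x y = F y x" and diag: "(\<Sum>x\<in>V. F x x) = 0"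
    and \<delta>: "0 < \<delta>" "\<delta> < 1" and \<epsilon>: "0 < \<epsilon>"
    and small: "\<epsilon> * ((2 * card V / \<delta> + 2 * \<mu>) * (2 + 4 * card V / g) + 4 * \<mu> / g) \<le> 2 - 4 * \<mu> / g"
  shows "(1 - \<delta>) * (2 * \<mu>) * (\<epsilon> * (\<Sum>x\<in>V. \<Sum>y\<in>V. (F x y)\<^sup>2) + (\<Sum>x\<in>V. (F x x)\<^sup>2))
    \<le> \<epsilon> * (\<Sum>x\<in>V. \<Sum>v\<in>V. \<Sum>y\<in>V. c x v * (F x y - F v y)\<^sup>2)
      + 2 * (\<Sum>x\<in>V. \<Sum>v\<in>V. c x v * (F x x - F v x)\<^sup>2)"
proof -
  define n where "n = real (card V)"
  define T where "T = (\<Sum>x\<in>V. (F x x)\<^sup>2)"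
  define Q where "Q = (\<Sum>x\<in>V. \<Sum>v\<in>V. c x v * (F x x - F v x)\<^sup>2)"
  define P where "P = (\<Sum>x\<in>V. \<Sum>v\<in>V. \<Sum>y\<in>V. c x v * (F x y - F v y)\<^sup>2)"
  define W where "W = (\<Sum>x\<in>V. \<Sum>y\<in>V. c x y * (F x y)\<^sup>2)"
  define N where "N = (\<Sum>x\<in>V. \<Sum>y\<in>V. nonadj x y * (F x y)\<^sup>2)"
  define C where "C = 2 + 4 * n / g"
  have n: "n \<ge> 0" by (simp add: n_def)
  have T0: "T \<ge> 0" by (simp add: T_def sum_nonneg)
  have Q0: "Q \<ge> 0" unfolding Q_def by (intro sum_nonneg mult_nonneg_nonneg cond_nonneg) auto
  have N0: "N \<ge> 0" unfolding N_def by (intro sum_nonneg mult_nonneg_nonneg nonadj_bounds) auto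
  have W0: "W \<ge> 0" unfolding W_def by (intro sum_nonneg mult_nonneg_nonneg cond_nonneg) auto
  have C0: "C \<ge> 0" using n g_pos by (simp add: C_def)

  have total: "(\<Sum>x\<in>V. \<Sum>y\<in>V. (F x y)\<^sup>2) = N + W + T"
  proof -
    have "(\<Sum>x\<in>V. \<Sum>y\<in>V. (F x y)\<^sup>2) = (\<Sum>x\<in>V. \<Sum>y\<in>V. nonadj x y * (F x y)\<^sup>2 + c x y * (F x y)\<^sup>2
        + (if x = y then (F x x)\<^sup>2 else 0))"
      by (intro sum.cong refl) (auto simp: nonadj_eq algebra_simps)
    then show ?thesis by (simp add: N_def W_def T_def sum.distrib finite_V)
  qed

  have gT: "g * T \<le> 2 * Q"
  proof -
    have "2 * g * T \<le> (\<Sum>x\<in>V. \<Sum>v\<in>V. c x v * (F x x - F v v)\<^sup>2)"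
      unfolding T_def by (rule poincare[OF diag])
    also have "\<dots> \<le> (\<Sum>x\<in>V. \<Sum>v\<in>V. 2 * (c x v * (F x x - F v x)\<^sup>2) + 2 * (c x v * (F v v - F x v)\<^sup>2))"
    proof (intro sum_mono)
      fix x v assume "x \<in> V" "v \<in> V"
      have "(F x x - F v v)\<^sup>2 \<le> 2 * (F x x - F v x)\<^sup>2 + 2 * (F v v - F x v)\<^sup>2"
        using zero_le_power2[of "F x x + F v v - 2 * F v x"] F[of x v]
        by (simp add: power2_eq_square algebra_simps)
      from mult_left_mono[OF this cond_nonneg[OF \<open>x \<in> V\<close> \<open>v \<in> V\<close>]]
      show "c x v * (F x x - F v v)\<^sup>2 \<le> 2 * (c x v * (F x x - F v x)\<^sup>2) + 2 * (c x v * (F v v - F x v)\<^sup>2)"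
        by (simp add: algebra_simps)
    qed
    also have "\<dots> = 2 * Q + 2 * (\<Sum>x\<in>V. \<Sum>v\<in>V. c x v * (F v v - F x v)\<^sup>2)"
      by (simp add: sum.distrib Q_def sum_distrib_left)
    also have "(\<Sum>x\<in>V. \<Sum>v\<in>V. c x v * (F v v - F x v)\<^sup>2) = Q"
      unfolding Q_def by (subst sum.swap, intro sum.cong refl) (simp add: sym)
    finally show ?thesis by (simp add: mult.commute)
  qed

  have WQ: "W \<le> C * Q"
  proof -
    have "W \<le> (\<Sum>x\<in>V. \<Sum>v\<in>V. 2 * (c x v * (F x x - F v x)\<^sup>2) + 2 * (c x v * (F x x)\<^sup>2))"
      unfolding W_def
    proof (intro sum_mono)
      fix x v assume "x \<in> V" "v \<in> V"
      have "(F x v)\<^sup>2 \<le> 2 * (F x x - F v x)\<^sup>2 + 2 * (F x x)\<^sup>2"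
        using zero_le_power2[of "2 * F x x - F v x"] F[of x v]
        by (simp add: power2_eq_square algebra_simps)
      from mult_left_mono[OF this cond_nonneg[OF \<open>x \<in> V\<close> \<open>v \<in> V\<close>]]
      show "c x v * (F x v)\<^sup>2 \<le> 2 * (c x v * (F x x - F v x)\<^sup>2) + 2 * (c x v * (F x x)\<^sup>2)"
        by (simp add: algebra_simps)
    qed
    also have "\<dots> = 2 * Q + 2 * (\<Sum>x\<in>V. (\<Sum>v\<in>V. c x v) * (F x x)\<^sup>2)"
      by (simp add: sum.distrib Q_def sum_distrib_left sum_distrib_right)
    also have "(\<Sum>x\<in>V. (\<Sum>v\<in>V. c x v) * (F x x)\<^sup>2) \<le> (\<Sum>x\<in>V. n * (F x x)\<^sup>2)"
      unfolding n_def by (intro sum_mono mult_right_mono degree_le) auto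
    also have "\<dots> = n * T" by (simp add: T_def sum_distrib_left)
    also have "n * T \<le> n * (2 * Q / g)"
      using gT g_pos n by (intro mult_left_mono) (simp_all add: field_simps)
    finally show ?thesis by (simp add: C_def algebra_simps)
  qed

  have PN: "2 * \<mu> * (1 - \<delta>) * N - 2 * n / \<delta> * W \<le> P"
  proof -
    \<comment> \<open>selects the jumps of the first particle by which a separated pair becomes adjacent\<close>
    define r where "r = (\<lambda>x v y. nonadj x y * c v y * c x v)"
    have r: "0 \<le> r x v y" "r x v y \<le> c v y" if "x \<in> V" "v \<in> V" "y \<in> V" for x v y
      using that nonadj_bounds[of x y] unit_conductance[of v y] unit_conductance[of x v]
      by (auto simp: r_def)
    have S1: "(\<Sum>x\<in>V. \<Sum>v\<in>V. \<Sum>y\<in>V. r x v y * (F x y)\<^sup>2) = \<mu> * N"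
    proof -
      have "(\<Sum>x\<in>V. \<Sum>v\<in>V. \<Sum>y\<in>V. r x v y * (F x y)\<^sup>2)
          = (\<Sum>x\<in>V. \<Sum>y\<in>V. nonadj x y * (F x y)\<^sup>2 * (\<Sum>v\<in>V. c x v * c v y))"
        by (rule sum.cong[OF refl], subst sum.swap) (simp add: r_def sum_distrib_left mult_ac)
      also have "\<dots> = (\<Sum>x\<in>V. \<Sum>y\<in>V. nonadj x y * (F x y)\<^sup>2 * \<mu>)"
        by (intro sum.cong refl) (auto simp: nonadj_def codegree)
      finally show ?thesis by (simp add: N_def sum_distrib_left mult_ac)
    qed
    have S2: "(\<Sum>x\<in>V. \<Sum>v\<in>V. \<Sum>y\<in>V. r x v y * (F v y)\<^sup>2) \<le> n * W"
    proof -
      have "(\<Sum>x\<in>V. \<Sum>v\<in>V. \<Sum>y\<in>V. r x v y * (F v y)\<^sup>2) \<le> (\<Sum>x\<in>V. \<Sum>v\<in>V. \<Sum>y\<in>V. c v y * (F v y)\<^sup>2)"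
        by (intro sum_mono mult_right_mono r) auto
      then show ?thesis by (simp add: W_def n_def)
    qed
    have S3: "(\<Sum>x\<in>V. \<Sum>v\<in>V. \<Sum>y\<in>V. (1 - \<delta>) * (r x v y * (F x y)\<^sup>2) - 1 / \<delta> * (r x v y * (F v y)\<^sup>2))
        \<le> (\<Sum>x\<in>V. \<Sum>v\<in>V. \<Sum>y\<in>V. r x v y * (F x y - F v y)\<^sup>2)"
    proof (intro sum_mono)
      fix x v y assume V: "x \<in> V" "v \<in> V" "y \<in> V"
      \<comment> \<open>Young inequality, since \<open>F\<close> need not vanish on edges\<close>
      have "(1 - \<delta>) * a\<^sup>2 - 1 / \<delta> * b\<^sup>2 \<le> (a - b)\<^sup>2" for a b :: real
      proof -
        have "(a - b)\<^sup>2 - ((1 - \<delta>) * a\<^sup>2 - 1 / \<delta> * b\<^sup>2) = (\<delta> * a - b)\<^sup>2 / \<delta> + b\<^sup>2"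
          using \<delta> by (simp add: field_simps power2_eq_square)
        also have "\<dots> \<ge> 0" using \<delta> by simp
        finally show ?thesis by simp
      qed
      from mult_left_mono[OF this[of "F x y" "F v y"] r(1)[OF V]]
      show "(1 - \<delta>) * (r x v y * (F x y)\<^sup>2) - 1 / \<delta> * (r x v y * (F v y)\<^sup>2) \<le> r x v y * (F x y - F v y)\<^sup>2"
        by (simp add: algebra_simps)
    qed
    have S4: "2 * (\<Sum>x\<in>V. \<Sum>v\<in>V. \<Sum>y\<in>V. r x v y * (F x y - F v y)\<^sup>2) \<le> P"
    proof -
      have "(\<Sum>x\<in>V. \<Sum>v\<in>V. \<Sum>y\<in>V. r x v y * (F x y - F v y)\<^sup>2)
          = (\<Sum>x\<in>V. \<Sum>v\<in>V. \<Sum>y\<in>V. r v x y * (F x y - F v y)\<^sup>2)"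
        by (subst sum.swap, intro sum.cong refl) (simp add: power2_commute)
      then have "2 * (\<Sum>x\<in>V. \<Sum>v\<in>V. \<Sum>y\<in>V. r x v y * (F x y - F v y)\<^sup>2)
          = (\<Sum>x\<in>V. \<Sum>v\<in>V. \<Sum>y\<in>V. (r x v y + r v x y) * (F x y - F v y)\<^sup>2)"
        by (simp add: sum.distrib distrib_right)
      also have "\<dots> \<le> P"
        unfolding P_def
      proof (intro sum_mono mult_right_mono)
        fix x v y assume V: "x \<in> V" "v \<in> V" "y \<in> V"
        \<comment> \<open>a jump and its reversal cannot both lead from a separated pair to an edge\<close>
        show "r x v y + r v x y \<le> c x v"
          using unit_conductance[OF V(1,3)] unit_conductance[OF V(2,3)] unit_conductance[OF V(1,2)]
            sym[OF V(1,2)]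
          by (auto simp: r_def nonadj_def)
      qed auto
      finally show ?thesis .
    qed
    have S5: "1 / \<delta> * (\<Sum>x\<in>V. \<Sum>v\<in>V. \<Sum>y\<in>V. r x v y * (F v y)\<^sup>2) \<le> 1 / \<delta> * (n * W)"
      using S2 \<delta> by (intro mult_left_mono) auto
    have "(1 - \<delta>) * (\<mu> * N) - 1 / \<delta> * (n * W)
        \<le> (\<Sum>x\<in>V. \<Sum>v\<in>V. \<Sum>y\<in>V. r x v y * (F x y - F v y)\<^sup>2)"
      using diff_left_mono[OF S5, of "(1 - \<delta>) * (\<mu> * N)"] S3
      unfolding sum_subtractf sum_distrib_left[symmetric] S1 by (rule order_trans)
    then have "2 * ((1 - \<delta>) * (\<mu> * N) - 1 / \<delta> * (n * W)) \<le> P"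
      using S4 by (intro order_trans[OF mult_left_mono S4]) auto
    moreover have "2 * ((1 - \<delta>) * (\<mu> * N) - 1 / \<delta> * (n * W))
        = 2 * \<mu> * (1 - \<delta>) * N - 2 * n / \<delta> * W" by (simp add: algebra_simps)
    ultimately show ?thesis by metis
  qed

  have "2 * \<mu> * (\<epsilon> * W + (1 + \<epsilon>) * T) + \<epsilon> * (2 * n / \<delta>) * W \<le> 2 * Q"
  proof -
    have "2 * \<mu> * (\<epsilon> * W + (1 + \<epsilon>) * T) + \<epsilon> * (2 * n / \<delta>) * W
        = \<epsilon> * (2 * \<mu> + 2 * n / \<delta>) * W + 2 * \<mu> * (1 + \<epsilon>) * T"
      by (simp add: algebra_simps)
    also have "\<dots> \<le> \<epsilon> * (2 * \<mu> + 2 * n / \<delta>) * (C * Q) + 2 * \<mu> * (1 + \<epsilon>) * (2 * Q / g)"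
    proof (intro add_mono mult_left_mono)
      show "T \<le> 2 * Q / g" using gT g_pos by (simp add: pos_le_divide_eq mult.commute)
    qed (use WQ \<epsilon> \<delta> codegree_pos n in auto)
    also have "\<dots> = (\<epsilon> * ((2 * n / \<delta> + 2 * \<mu>) * C + 4 * \<mu> / g) + 4 * \<mu> / g) * Q"
      by (simp add: algebra_simps)
    also have "\<dots> \<le> 2 * Q" using small Q0 by (intro mult_right_mono) (simp_all add: n_def C_def)
    finally show ?thesis .
  qed
  moreover have "\<epsilon> * (2 * \<mu> * (1 - \<delta>) * N - 2 * n / \<delta> * W) \<le> \<epsilon> * P"
    using PN \<epsilon> by (intro mult_left_mono) auto
  moreover have "(1 - \<delta>) * (2 * \<mu> * (\<epsilon> * W + (1 + \<epsilon>) * T)) \<le> 1 * (2 * \<mu> * (\<epsilon> * W + (1 + \<epsilon>) * T))"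
    using \<delta> \<epsilon> W0 T0 codegree_pos by (intro mult_right_mono) auto
  ultimately have "(1 - \<delta>) * (2 * \<mu>) * (\<epsilon> * (N + W + T) + T) \<le> \<epsilon> * P + 2 * Q"
    by (simp add: algebra_simps)
  then show ?thesis unfolding total unfolding T_def P_def Q_def .
qed

lemma sip_homogeneous: "\<epsilon> > 0 \<Longrightarrow> sip V c (\<lambda>_. \<epsilon>)"
  by unfold_locales simp

lemma card_V: "card V > 0"
  using graph by (simp add: weighted_graph_def)

lemma gap_one_particle:
  fixes \<epsilon> :: real
  assumes "\<epsilon> > 0"
  shows "gap V c (\<lambda>_. \<epsilon>) 1 = \<epsilon> * g"
proof -
  interpret sip V c "\<lambda>_. \<epsilon>" by (rule sip_homogeneous[OF assms])
  obtain a b where ab: "a \<in> V" "b \<in> V" "a \<noteq> b" using not_complete by blast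
  have inner: "one.inner_w f h = \<epsilon> * (\<Sum>x\<in>V. f (one_particle x) * h (one_particle x))" for f h
    unfolding inner1 by (simp add: sum_distrib_left)
  have energy: "one.energy f f
      = \<epsilon>\<^sup>2 / 2 * (\<Sum>x\<in>V. \<Sum>v\<in>V. c x v * (f (one_particle x) - f (one_particle v))\<^sup>2)" for f
    unfolding energy1 sum_distrib_left
    by (intro sum.cong refl) (simp add: power2_eq_square)
  have poinc: "\<epsilon> * g * one.inner_w f f \<le> one.energy f f" if "one.inner_w f (\<lambda>_. 1) = 0" for f
  proof -
    have "(\<Sum>x\<in>V. f (one_particle x)) = 0" using that assms unfolding inner by simp
    from mult_left_mono[OF poincare[OF this], of "\<epsilon>\<^sup>2 / 2"]
    show ?thesis unfolding inner energy by (simp add: power2_eq_square mult_ac)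
  qed
  have X: "one_particle a \<in> configs V 1" "one_particle b \<in> configs V 1"
    using ab unfolding configs_1[OF finite_V] by auto
  have "one_particle a a \<noteq> one_particle b a" using ab(3) by (simp add: one_particle_def)
  then have ne: "one_particle a \<noteq> one_particle b" by auto
  note bounds = one.second_eigenvalue[OF mult_pos_pos[OF assms g_pos] poinc X ne, folded gap_spectrum(1)]
  obtain h where h: "(\<Sum>x\<in>V. h x) = 0" "\<exists>x\<in>V. h x \<noteq> 0"
      "(\<Sum>x\<in>V. \<Sum>y\<in>V. c x y * (h x - h y)\<^sup>2) = 2 * g * (\<Sum>x\<in>V. (h x)\<^sup>2)"
    using poincare_sharp by blast
  define f where "f = (\<lambda>\<eta>. \<Sum>x\<in>V. h x * real (\<eta> x))"
  have f: "f (one_particle x) = h x" if "x \<in> V" for x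
    using that finite_V by (simp add: f_def one_particle_def of_bool_def if_distrib cong: if_cong)
  have pos: "(\<Sum>x\<in>V. (h x)\<^sup>2) > 0"
    using h(2) finite_V by (metis sum_pos2 zero_le_power2 zero_less_power2)
  have "gap V c (\<lambda>_. \<epsilon>) 1 * (one.inner_w f f - (one.inner_w f (\<lambda>_. 1))\<^sup>2 / one.inner_w (\<lambda>_. 1) (\<lambda>_. 1))
      \<le> one.energy f f" by (rule bounds(2))
  moreover have "one.inner_w f f = \<epsilon> * (\<Sum>x\<in>V. (h x)\<^sup>2)"
    unfolding inner by (simp add: f power2_eq_square)
  moreover have "one.inner_w f (\<lambda>_. 1) = 0" unfolding inner by (simp add: f h(1))
  moreover have "one.energy f f = \<epsilon> * g * (\<epsilon> * (\<Sum>x\<in>V. (h x)\<^sup>2))"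
  proof -
    have "one.energy f f = \<epsilon>\<^sup>2 / 2 * (\<Sum>x\<in>V. \<Sum>v\<in>V. c x v * (h x - h v)\<^sup>2)"
      unfolding energy by (simp add: f)
    then show ?thesis unfolding h(3) by (simp add: power2_eq_square)
  qed
  ultimately have "gap V c (\<lambda>_. \<epsilon>) 1 * (\<epsilon> * (\<Sum>x\<in>V. (h x)\<^sup>2)) \<le> \<epsilon> * g * (\<epsilon> * (\<Sum>x\<in>V. (h x)\<^sup>2))"
    by simp
  then have "gap V c (\<lambda>_. \<epsilon>) 1 \<le> \<epsilon> * g" using pos assms by (simp add: mult.commute)
  with bounds(1) show ?thesis by simp
qed

text \<open>Here \<open>M\<close> is the number of ordered separated pairs. Their total weight is \<open>\<epsilon>\<^sup>2 M\<close> out of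
\<open>\<epsilon>\<^sup>2 n\<^sup>2 + \<epsilon> n\<close> with \<open>n = card V\<close>, so centring their indicator, the test function for the upper bound,
changes its squared norm only by a factor \<open>1 - O(\<epsilon>)\<close>.\<close>

lemma gap_two_particles_bounds:
  fixes \<epsilon> \<delta> :: real
  assumes \<epsilon>: "\<epsilon> > 0" and \<delta>: "0 < \<delta>" "\<delta> < 1"
    and small: "\<epsilon> * ((2 * card V / \<delta> + 2 * \<mu>) * (2 + 4 * card V / g) + 4 * \<mu> / g) \<le> 2 - 4 * \<mu> / g"
  defines "M \<equiv> (\<Sum>x\<in>V. \<Sum>y\<in>V. nonadj x y)"
  shows "\<epsilon> * ((1 - \<delta>) * (2 * \<mu>)) \<le> gap V c (\<lambda>_. \<epsilon>) 2"
    and "gap V c (\<lambda>_. \<epsilon>) 2 * (1 - \<epsilon> * M / (\<epsilon> * (card V)\<^sup>2 + card V)) \<le> \<epsilon> * (2 * \<mu>)"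
proof -
  interpret sip V c "\<lambda>_. \<epsilon>" by (rule sip_homogeneous[OF \<epsilon>])
  obtain a b where ab: "a \<in> V" "b \<in> V" "a \<noteq> b" "c a b = 0" using not_complete by blast
  define S T P Q where "S = (\<lambda>F. \<Sum>x\<in>V. \<Sum>y\<in>V. (F x y :: real)\<^sup>2)"
    and "T = (\<lambda>F. \<Sum>x\<in>V. (F x x :: real)\<^sup>2)"
    and "P = (\<lambda>F. \<Sum>x\<in>V. \<Sum>v\<in>V. \<Sum>y\<in>V. c x v * (F x y - F v y)\<^sup>2)"
    and "Q = (\<lambda>F. \<Sum>x\<in>V. \<Sum>v\<in>V. c x v * (F x x - F v x)\<^sup>2)"
  have inner_gen: "two.inner_w f h = \<epsilon> * (\<epsilon> * (\<Sum>x\<in>V. \<Sum>y\<in>V. f (two_particles x y) * h (two_particles x y))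
      + (\<Sum>x\<in>V. f (two_particles x x) * h (two_particles x x)))" for f h
  proof -
    have "two.inner_w f h = (\<Sum>x\<in>V. \<Sum>y\<in>V. \<epsilon> * (\<epsilon> * (f (two_particles x y) * h (two_particles x y)))
        + (if x = y then \<epsilon> * (f (two_particles x x) * h (two_particles x x)) else 0))"
      unfolding inner2 by (intro sum.cong refl) (auto simp: algebra_simps)
    then show ?thesis by (simp add: sum.distrib finite_V sum_distrib_left algebra_simps)
  qed
  have inner: "two.inner_w f f = \<epsilon> * (\<epsilon> * S (\<lambda>x y. f (two_particles x y)) + T (\<lambda>x y. f (two_particles x y)))" for f
    unfolding inner_gen S_def T_def by (simp add: power2_eq_square)
  have energy: "two.energy f f = \<epsilon>\<^sup>2 * (\<epsilon> * P (\<lambda>x y. f (two_particles x y)) + 2 * Q (\<lambda>x y. f (two_particles x y)))"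
    for f
  proof -
    let ?F = "\<lambda>x y. f (two_particles x y)"
    have "two.energy f f = (\<Sum>x\<in>V. \<Sum>v\<in>V. \<Sum>y\<in>V. \<epsilon>\<^sup>2 * (\<epsilon> * (c x v * (?F x y - ?F v y)\<^sup>2))
        + (if x = y then \<epsilon>\<^sup>2 * (c x v * (?F x x - ?F v x)\<^sup>2) else 0)
        + (if v = y then \<epsilon>\<^sup>2 * (c x v * (?F v v - ?F x v)\<^sup>2) else 0))"
      unfolding energy2
      by (intro sum.cong refl)
         (auto simp: rate2_def loop_free power2_eq_square algebra_simps)
    also have "\<dots> = \<epsilon>\<^sup>2 * (\<epsilon> * P ?F) + \<epsilon>\<^sup>2 * Q ?F + \<epsilon>\<^sup>2 * (\<Sum>x\<in>V. \<Sum>v\<in>V. c x v * (?F v v - ?F x v)\<^sup>2)"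
      by (simp add: sum.distrib finite_V P_def Q_def sum_distrib_left)
    also have "(\<Sum>x\<in>V. \<Sum>v\<in>V. c x v * (?F v v - ?F x v)\<^sup>2) = Q ?F"
      unfolding Q_def by (subst sum.swap, intro sum.cong refl) (simp add: sym)
    finally show ?thesis by (simp add: algebra_simps)
  qed

  have poinc: "\<epsilon> * ((1 - \<delta>) * (2 * \<mu>)) * two.inner_w f f \<le> two.energy f f"
    if f: "two.inner_w f (\<lambda>_. 1) = 0" for f
  proof -
    \<comment> \<open>recentring at the mean over the diagonal keeps the energy and only increases the norm\<close>
    define b where "b = (\<Sum>x\<in>V. f (two_particles x x)) / card V"
    define h where "h = (\<lambda>\<eta>. f \<eta> - b)"
    have "two.inner_w h h = two.inner_w f f + b\<^sup>2 * two.inner_w (\<lambda>_. 1) (\<lambda>_. 1)"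
      using two.inner_lin[of h f "- b" "\<lambda>_. 1"] two.inner_lin[of f f "- b" "\<lambda>_. 1"]
        two.inner_lin[of "\<lambda>_. 1" f "- b" "\<lambda>_. 1"] f
        two.inner_commute[of h f] two.inner_commute[of h "\<lambda>_. 1"] two.inner_commute[of "\<lambda>_. 1" f]
      by (simp add: h_def power2_eq_square)
    then have "two.inner_w f f \<le> two.inner_w h h" using two.inner_nonneg[of "\<lambda>_. 1"] by simp
    then have "\<epsilon> * ((1 - \<delta>) * (2 * \<mu>)) * two.inner_w f f \<le> \<epsilon> * ((1 - \<delta>) * (2 * \<mu>)) * two.inner_w h h"
      using \<epsilon> \<delta> codegree_pos by (intro mult_left_mono) auto
    also have "\<dots> \<le> two.energy h h"
    proof -
      let ?F = "\<lambda>x y. h (two_particles x y)"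
      have "(\<Sum>x\<in>V. ?F x x) = 0" using card_V by (simp add: h_def sum_subtractf b_def)
      from slow_energy_lower_bound[of ?F, OF _ this \<delta> \<epsilon> small]
      have "(1 - \<delta>) * (2 * \<mu>) * (\<epsilon> * S ?F + T ?F) \<le> \<epsilon> * P ?F + 2 * Q ?F"
        unfolding S_def T_def P_def Q_def using two_particles_commute by metis
      from mult_left_mono[OF this, of "\<epsilon>\<^sup>2"]
      show ?thesis by (simp add: inner energy power2_eq_square mult_ac)
    qed
    also have "two.energy h h = two.energy f f" by (simp add: h_def two.energy_shift)
    finally show ?thesis .
  qed
  have X: "two_particles a a \<in> configs V 2" "two_particles a b \<in> configs V 2"
    using ab unfolding configs_2[OF finite_V] by auto
  have ne: "two_particles a a \<noteq> two_particles a b" using ab(3) by (simp add: two_particles_eq_iff)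
  have K: "\<epsilon> * ((1 - \<delta>) * (2 * \<mu>)) > 0" using \<epsilon> \<delta> codegree_pos by simp
  note bounds = two.second_eigenvalue[OF K poinc X ne, folded gap_spectrum(2)]
  show "\<epsilon> * ((1 - \<delta>) * (2 * \<mu>)) \<le> gap V c (\<lambda>_. \<epsilon>) 2" by (rule bounds(1))

  obtain f where f: "\<And>x y. f (two_particles x y) = nonadj x y"
    using lift_to_two_particles[of nonadj] nonadj_commute by blast
  have sq: "(nonadj x y)\<^sup>2 = nonadj x y" for x y by (simp add: nonadj_def)
  have diag: "nonadj x x = 0" for x by (simp add: nonadj_def)
  have "nonadj a b \<le> M"
  proof -
    have "nonadj a b \<le> (\<Sum>y\<in>V. nonadj a y)"
      using ab finite_V nonadj_bounds by (intro member_le_sum) auto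
    also have "\<dots> \<le> M" unfolding M_def
      using ab finite_V nonadj_bounds by (intro member_le_sum[of a V "\<lambda>x. \<Sum>y\<in>V. nonadj x y"] sum_nonneg) auto
    finally show ?thesis .
  qed
  then have M: "M > 0" using ab by (simp add: nonadj_def)
  have PF: "P nonadj = 2 * \<mu> * M"
  proof -
    have "P nonadj = (\<Sum>x\<in>V. \<Sum>v\<in>V. \<Sum>y\<in>V. nonadj x y * c x v * c v y)
        + (\<Sum>x\<in>V. \<Sum>v\<in>V. \<Sum>y\<in>V. nonadj v y * c v x * c x y)"
      unfolding P_def sum.distrib[symmetric]
    proof (intro sum.cong refl)
      fix x v y assume V: "x \<in> V" "v \<in> V" "y \<in> V"
      show "c x v * (nonadj x y - nonadj v y)\<^sup>2 = nonadj x y * c x v * c v y + nonadj v y * c v x * c x y"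
        using V unit_conductance[OF V(1,3)] unit_conductance[OF V(2,3)] unit_conductance[OF V(1,2)]
          sym[OF V(1,2)]
        by (auto simp: nonadj_def sym)
    qed
    also have "(\<Sum>x\<in>V. \<Sum>v\<in>V. \<Sum>y\<in>V. nonadj v y * c v x * c x y)
        = (\<Sum>x\<in>V. \<Sum>v\<in>V. \<Sum>y\<in>V. nonadj x y * c x v * c v y)" by (rule sum.swap)
    also have "(\<Sum>x\<in>V. \<Sum>v\<in>V. \<Sum>y\<in>V. nonadj x y * c x v * c v y)
        = (\<Sum>x\<in>V. \<Sum>y\<in>V. nonadj x y * (\<Sum>v\<in>V. c x v * c v y))"
      by (rule sum.cong[OF refl], subst sum.swap) (simp add: sum_distrib_left mult.assoc)
    also have "\<dots> = (\<Sum>x\<in>V. \<Sum>y\<in>V. nonadj x y * \<mu>)"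
      using codegree by (intro sum.cong refl) (fastforce simp: nonadj_def)
    also have "\<dots> = \<mu> * M" by (simp add: M_def sum_distrib_left mult.commute)
    finally show ?thesis by simp
  qed
  have QF: "Q nonadj = 0"
  proof -
    have "c x v * (nonadj x x - nonadj v x)\<^sup>2 = 0" if "x \<in> V" "v \<in> V" for x v
      using sym[OF that] by (auto simp: nonadj_def)
    then show ?thesis unfolding Q_def by (intro sum.neutral ballI)
  qed
  define n where "n = real (card V)"
  have n: "n > 0" using card_V by (simp add: n_def)
  have i1: "two.inner_w f f = \<epsilon>\<^sup>2 * M"
    unfolding inner by (simp add: f S_def T_def sq diag M_def) (simp add: power2_eq_square)
  have i2: "two.inner_w f (\<lambda>_. 1) = \<epsilon>\<^sup>2 * M"
    unfolding inner_gen by (simp add: f diag M_def power2_eq_square)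
  have i3: "two.inner_w (\<lambda>_. 1) (\<lambda>_. 1) = \<epsilon> * (\<epsilon> * n\<^sup>2 + n)"
    unfolding inner_gen by (simp add: n_def power2_eq_square)
  have e: "two.energy f f = \<epsilon>\<^sup>2 * M * (\<epsilon> * (2 * \<mu>))"
    unfolding energy by (simp add: f PF QF)
  have "\<epsilon>\<^sup>2 * M - (\<epsilon>\<^sup>2 * M)\<^sup>2 / (\<epsilon> * (\<epsilon> * n\<^sup>2 + n)) = \<epsilon>\<^sup>2 * M * (1 - \<epsilon> * M / (\<epsilon> * n\<^sup>2 + n))"
  proof -
    have "(\<epsilon>\<^sup>2 * M)\<^sup>2 / (\<epsilon> * d) = \<epsilon>\<^sup>2 * M * (\<epsilon> * M / d)" for d
      using \<epsilon> by (simp add: power2_eq_square)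
    then show ?thesis by (simp add: right_diff_distrib)
  qed
  then have "\<epsilon>\<^sup>2 * M * (gap V c (\<lambda>_. \<epsilon>) 2 * (1 - \<epsilon> * M / (\<epsilon> * n\<^sup>2 + n))) \<le> \<epsilon>\<^sup>2 * M * (\<epsilon> * (2 * \<mu>))"
    using bounds(2)[of f] unfolding i1 i2 i3 e by (simp add: mult_ac)
  then show "gap V c (\<lambda>_. \<epsilon>) 2 * (1 - \<epsilon> * M / (\<epsilon> * (card V)\<^sup>2 + card V)) \<le> \<epsilon> * (2 * \<mu>)"
    using M \<epsilon> by (simp add: mult_le_cancel_left_pos n_def)
qed

theorem gap_ratio_tendsto:
  "((\<lambda>\<epsilon>. gap V c (\<lambda>_. \<epsilon>) 2 / gap V c (\<lambda>_. \<epsilon>) 1) \<longlongrightarrow> 2 * \<mu> / g) (at_right 0)"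
proof -
  define n where "n = real (card V)"
  have n: "n > 0" using card_V by (simp add: n_def)
  define M where "M = (\<Sum>x\<in>V. \<Sum>y\<in>V. nonadj x y)"
  have pos: "\<forall>\<^sub>F \<epsilon> in at_right 0. (\<epsilon>::real) > 0" by (rule eventually_at_right_less)
  have small: "\<forall>\<^sub>F \<epsilon> in at_right 0.
      \<epsilon> * ((2 * card V / \<delta> + 2 * \<mu>) * (2 + 4 * card V / g) + 4 * \<mu> / g) \<le> 2 - 4 * \<mu> / g"
    for \<delta> :: real
  proof -
    let ?C = "(2 * card V / \<delta> + 2 * \<mu>) * (2 + 4 * card V / g) + 4 * \<mu> / g"
    have "((\<lambda>\<epsilon>. \<epsilon> * ?C) \<longlongrightarrow> 0 * ?C) (at_right 0)" by (intro tendsto_intros)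
    moreover have "0 * ?C < 2 - 4 * \<mu> / g" using codegree_small g_pos by (simp add: field_simps)
    ultimately have "\<forall>\<^sub>F \<epsilon> in at_right 0. \<epsilon> * ?C < 2 - 4 * \<mu> / g" by (rule order_tendstoD(2))
    then show ?thesis by eventually_elim simp
  qed
  have scaled: "((\<lambda>\<epsilon>. gap V c (\<lambda>_. \<epsilon>) 2 / \<epsilon>) \<longlongrightarrow> 2 * \<mu>) (at_right 0)"
  proof (rule order_tendstoI)
    fix a assume a: "a < 2 * \<mu>"
    define \<delta> where "\<delta> = min (1 / 2) ((2 * \<mu> - a) / (4 * \<mu>))"
    have \<delta>: "0 < \<delta>" "\<delta> < 1" using a codegree_pos by (auto simp: \<delta>_def)
    have "\<delta> * (4 * \<mu>) \<le> 2 * \<mu> - a"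
      using codegree_pos by (simp add: \<delta>_def flip: pos_le_divide_eq)
    then have "a < (1 - \<delta>) * (2 * \<mu>)" using mult_pos_pos[OF \<delta>(1) codegree_pos] by (simp add: algebra_simps)
    note a\<delta> = this
    show "\<forall>\<^sub>F \<epsilon> in at_right 0. a < gap V c (\<lambda>_. \<epsilon>) 2 / \<epsilon>"
      using pos small[of \<delta>]
    proof eventually_elim
      case (elim \<epsilon>)
      then have "(1 - \<delta>) * (2 * \<mu>) \<le> gap V c (\<lambda>_. \<epsilon>) 2 / \<epsilon>"
        using gap_two_particles_bounds(1)[OF _ \<delta>, of \<epsilon>] by (simp add: pos_le_divide_eq mult.commute)
      with a\<delta> show ?case by linarith
    qed
  next
    fix a assume a: "a > 2 * \<mu>"
    define s where "s = (\<lambda>\<epsilon>. 1 - \<epsilon> * M / (\<epsilon> * n\<^sup>2 + n))"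
    have "(s \<longlongrightarrow> 1 - 0 * M / (0 * n\<^sup>2 + n)) (at_right 0)"
      unfolding s_def using n by (intro tendsto_intros) auto
    then have s: "(s \<longlongrightarrow> 1) (at_right 0)" by simp
    then have "((\<lambda>\<epsilon>. 2 * \<mu> / s \<epsilon>) \<longlongrightarrow> 2 * \<mu> / 1) (at_right 0)" by (intro tendsto_intros) auto
    then have "\<forall>\<^sub>F \<epsilon> in at_right 0. 2 * \<mu> / s \<epsilon> < a" using a by (intro order_tendstoD(2)) auto
    moreover have "\<forall>\<^sub>F \<epsilon> in at_right 0. s \<epsilon> > 0" using s by (rule order_tendstoD(1)) simp
    ultimately show "\<forall>\<^sub>F \<epsilon> in at_right 0. gap V c (\<lambda>_. \<epsilon>) 2 / \<epsilon> < a"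
      using pos small[of "1 / 2"]
    proof eventually_elim
      case (elim \<epsilon>)
      then have "gap V c (\<lambda>_. \<epsilon>) 2 * s \<epsilon> \<le> \<epsilon> * (2 * \<mu>)"
        using gap_two_particles_bounds(2)[of \<epsilon> "1 / 2"] by (simp add: s_def M_def n_def)
      then have "gap V c (\<lambda>_. \<epsilon>) 2 / \<epsilon> \<le> 2 * \<mu> / s \<epsilon>" using elim by (simp add: field_simps)
      with elim show ?case by linarith
    qed
  qed
  have "((\<lambda>\<epsilon>. gap V c (\<lambda>_. \<epsilon>) 2 / \<epsilon> / g) \<longlongrightarrow> 2 * \<mu> / g) (at_right 0)"
    using g_pos by (intro tendsto_divide scaled tendsto_const) auto
  moreover have "\<forall>\<^sub>F \<epsilon> in at_right 0. gap V c (\<lambda>_. \<epsilon>) 2 / \<epsilon> / g = gap V c (\<lambda>_. \<epsilon>) 2 / gap V c (\<lambda>_. \<epsilon>) 1"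
    using pos
  proof eventually_elim
    case (elim \<epsilon>)
    then show ?case unfolding gap_one_particle[OF elim] by simp
  qed
  ultimately show ?thesis by (rule Lim_transform_eventually)
qed

end

section \<open>Rook graphs\<close>

context
  fixes q :: nat
  assumes q: "q > 1"
begin

text \<open>The square \<open>(x div q, x mod q)\<close> of a \<open>q \<times> q\<close> board is encoded by \<open>x < q * q\<close>, and two squares are
adjacent when a rook can move from one to the other. For \<open>x = y\<close> both indicators equal \<open>1\<close>, which the last
term cancels.\<close>

definition rook :: "nat \<Rightarrow> nat \<Rightarrow> real" where
  "rook x y = of_bool (x div q = y div q) + of_bool (x mod q = y mod q) - 2 * of_bool (x = y)"

lemma coords_eq_iff: "x = y \<longleftrightarrow> x div q = y div q \<and> x mod q = y mod q"
  by (metis div_mult_mod_eq)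

lemma coords: "j < q \<Longrightarrow> (i * q + j) div q = i" "j < q \<Longrightarrow> (i * q + j) mod q = j"
  using q by auto

lemma square_index: "i < q \<Longrightarrow> j < q \<Longrightarrow> i * q + j < q * q"
proof -
  assume "i < q" "j < q"
  then have "i * q + j < Suc i * q" by simp
  also have "\<dots> \<le> q * q" using \<open>i < q\<close> by (intro mult_le_mono1) simp
  finally show ?thesis .
qed

lemma sum_square: "(\<Sum>x<q * q. h x) = (\<Sum>i<q. \<Sum>j<q. h (i * q + j))" for h :: "nat \<Rightarrow> real"
proof -
  have "sum h {i * q..<i * q + q} = (\<Sum>j<q. h (i * q + j))" for i
    by (subst sum.atLeastLessThan_shift_0) (simp add: lessThan_atLeast0 o_def)
  then show ?thesis using sum.nat_group[of h q q] by simp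
qed

lemma rook_cases: "rook x y = 0 \<or> rook x y = 1"
  by (auto simp: rook_def coords_eq_iff[of x y])

lemma rook_coords:
  assumes "j < q" "l < q"
  shows "rook (i * q + j) (k * q + l) = of_bool (i = k) + of_bool (j = l) - 2 * of_bool (i = k \<and> j = l)"
proof -
  have "i * q + j = k * q + l \<longleftrightarrow> i = k \<and> j = l"
    by (subst coords_eq_iff) (simp add: coords assms)
  then show ?thesis unfolding rook_def by (simp add: coords assms)
qed

lemma weighted_graph_rook: "weighted_graph {..<q * q} rook"
  unfolding weighted_graph_def
proof (intro conjI ballI)
  show "card {..<q * q} \<ge> 2"
    using q mult_le_mono[of 2 q 1 q] by simp
  fix x y assume x: "x \<in> {..<q * q}" and y: "y \<in> {..<q * q}"
  show "rook x y = rook y x" unfolding rook_def by (simp add: eq_commute)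
  show "rook x y \<ge> 0" using rook_cases[of x y] by auto
  let ?E = "{(u, v). u \<in> {..<q * q} \<and> v \<in> {..<q * q} \<and> rook u v > 0}"
  have step: "(u, v) \<in> ?E\<^sup>*"
    if "u < q * q" "v < q * q" "u div q = v div q \<or> u mod q = v mod q" for u v
  proof (cases "u = v")
    case False
    then have "rook u v > 0" using that(3) by (auto simp: rook_def coords_eq_iff[of u v])
    then show ?thesis using that by auto
  qed auto
  define z where "z = x div q * q + y mod q"
  have "z < q * q"
    unfolding z_def using x q by (intro square_index) (auto simp: less_mult_imp_div_less)
  moreover have "z div q = x div q" "z mod q = y mod q" unfolding z_def using q by (simp_all add: coords)
  ultimately have "(x, z) \<in> ?E\<^sup>*" "(z, y) \<in> ?E\<^sup>*" using x y step[of x z] step[of z y] by simp_all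
  then show "(x, y) \<in> ?E\<^sup>*" by (rule rtrancl_trans)
next
  show "rook x x = 0" for x by (simp add: rook_def)
qed simp

text \<open>The common neighbours are the two other corners of the rectangle spanned by \<open>x\<close> and \<open>y\<close>.\<close>

lemma rook_codegree:
  assumes x: "x < q * q" and y: "y < q * q" and ne: "x \<noteq> y" "rook x y = 0"
  shows "(\<Sum>z<q * q. rook x z * rook z y) = 2"
proof -
  define i j k l where "i = x div q" and "j = x mod q" and "k = y div q" and "l = y mod q"
  have r: "i < q" "j < q" "k < q" "l < q"
    unfolding i_def j_def k_def l_def using x y q by (auto simp: less_mult_imp_div_less)
  have xy: "x = i * q + j" "y = k * q + l" by (simp_all add: i_def j_def k_def l_def)
  have d: "i \<noteq> k" "j \<noteq> l"
    using ne unfolding rook_def i_def j_def k_def l_def by (auto simp: coords_eq_iff[of x y])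
  have "(\<Sum>z<q * q. rook x z * rook z y)
      = (\<Sum>a<q. \<Sum>b<q. (if a = i then if b = l then 1 else 0 else 0) + (if a = k then if b = j then 1 else 0 else 0))"
    unfolding sum_square xy using d
    by (intro sum.cong refl) (auto simp: rook_coords r)
  also have "\<dots> = (\<Sum>a<q. (if a = i then 1 else 0) + (if a = k then 1 else 0))"
    using r by (intro sum.cong refl) (auto simp: sum.distrib)
  also have "\<dots> = 2" using r by (simp add: sum.distrib)
  finally show ?thesis .
qed

text \<open>Rows and columns are complete graphs, and in a complete graph the energy is, up to a factor, the variance.\<close>

lemma rook_energy:
  fixes h :: "nat \<Rightarrow> real"
  defines "H \<equiv> \<lambda>i j. h (i * q + j)"
  shows "(\<Sum>x<q * q. \<Sum>y<q * q. rook x y * (h x - h y)\<^sup>2)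
       = 4 * q * (\<Sum>x<q * q. (h x)\<^sup>2) - 2 * (\<Sum>i<q. (\<Sum>j<q. H i j)\<^sup>2) - 2 * (\<Sum>j<q. (\<Sum>i<q. H i j)\<^sup>2)"
proof -
  have pairs: "(\<Sum>a<q. \<Sum>b<q. (u a - u b)\<^sup>2) = 2 * q * (\<Sum>a<q. (u a)\<^sup>2) - 2 * (\<Sum>a<q. u a)\<^sup>2"
    for u :: "nat \<Rightarrow> real"
  proof -
    have "(\<Sum>a<q. \<Sum>b<q. (u a - u b)\<^sup>2) = (\<Sum>a<q. \<Sum>b<q. (u a)\<^sup>2 + (u b)\<^sup>2 - 2 * (u a * u b))"
      by (simp add: power2_eq_square algebra_simps)
    also have "\<dots> = 2 * q * (\<Sum>a<q. (u a)\<^sup>2) - 2 * (\<Sum>a<q. \<Sum>b<q. u a * u b)"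
      by (simp add: sum.distrib sum_subtractf sum_distrib_left mult.assoc)
    finally show ?thesis by (simp add: power2_eq_square sum_product)
  qed
  have "(\<Sum>x<q * q. \<Sum>y<q * q. rook x y * (h x - h y)\<^sup>2)
      = (\<Sum>i<q. \<Sum>j<q. \<Sum>k<q. \<Sum>l<q. (if k = i then (H i j - H i l)\<^sup>2 else 0) + (if l = j then (H i j - H k j)\<^sup>2 else 0))"
    unfolding sum_square by (intro sum.cong refl) (auto simp: rook_coords H_def)
  also have "\<dots> = (\<Sum>i<q. \<Sum>j<q. (\<Sum>l<q. (H i j - H i l)\<^sup>2) + (\<Sum>k<q. (H i j - H k j)\<^sup>2))"
  proof (intro sum.cong refl)
    fix i j assume "i \<in> {..<q}" "j \<in> {..<q}"
    then have "(\<Sum>l<q. if l = j then (H i j - H k j)\<^sup>2 else 0) = (H i j - H k j)\<^sup>2" for k by simp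
    moreover have "(\<Sum>k<q. \<Sum>l<q. if k = i then (H i j - H i l)\<^sup>2 else 0) = (\<Sum>l<q. (H i j - H i l)\<^sup>2)"
      using \<open>i \<in> {..<q}\<close> by (subst sum.swap) simp
    ultimately show "(\<Sum>k<q. \<Sum>l<q. (if k = i then (H i j - H i l)\<^sup>2 else 0) + (if l = j then (H i j - H k j)\<^sup>2 else 0))
        = (\<Sum>l<q. (H i j - H i l)\<^sup>2) + (\<Sum>k<q. (H i j - H k j)\<^sup>2)"
      by (simp add: sum.distrib)
  qed
  also have "\<dots> = (\<Sum>i<q. \<Sum>j<q. \<Sum>l<q. (H i j - H i l)\<^sup>2) + (\<Sum>j<q. \<Sum>i<q. \<Sum>k<q. (H i j - H k j)\<^sup>2)"
    by (simp only: sum.distrib) (rule arg_cong2[of _ _ _ _ "(+)"], rule refl, rule sum.swap)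
  also have "\<dots> = 2 * q * (\<Sum>i<q. \<Sum>j<q. (H i j)\<^sup>2) - 2 * (\<Sum>i<q. (\<Sum>j<q. H i j)\<^sup>2)
      + (2 * q * (\<Sum>j<q. \<Sum>i<q. (H i j)\<^sup>2) - 2 * (\<Sum>j<q. (\<Sum>i<q. H i j)\<^sup>2))"
    unfolding pairs by (simp add: sum_subtractf sum_distrib_left)
  also have "(\<Sum>j<q. \<Sum>i<q. (H i j)\<^sup>2) = (\<Sum>i<q. \<Sum>j<q. (H i j)\<^sup>2)" by (rule sum.swap)
  also have "(\<Sum>i<q. \<Sum>j<q. (H i j)\<^sup>2) = (\<Sum>x<q * q. (h x)\<^sup>2)" by (simp add: sum_square H_def)
  finally show ?thesis by simp
qed

text \<open>After the formula for the energy it remains to bound the squares of the row sums \<open>R i\<close> and column sums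
\<open>C j\<close> by \<open>q\<close> times the squared norm. Up to scaling, \<open>R i\<close> and \<open>C j\<close> are the orthogonal projections of \<open>h\<close>
onto functions of the row and of the column; on mean-zero functions these two ranges are
orthogonal, so this is the nonnegativity of the squared norm of what is left over.\<close>

lemma rook_poincare:
  fixes h :: "nat \<Rightarrow> real"
  assumes "(\<Sum>x<q * q. h x) = 0"
  shows "2 * q * (\<Sum>x<q * q. (h x)\<^sup>2) \<le> (\<Sum>x<q * q. \<Sum>y<q * q. rook x y * (h x - h y)\<^sup>2)"
proof -
  define H where "H = (\<lambda>i j. h (i * q + j))"
  define R where "R = (\<lambda>i. \<Sum>j<q. H i j)"
  define C where "C = (\<lambda>j. \<Sum>i<q. H i j)"
  have R0: "(\<Sum>i<q. R i) = 0" using assms unfolding sum_square by (simp add: R_def H_def)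
  have "0 \<le> (\<Sum>i<q. \<Sum>j<q. (q * H i j - (R i + C j))\<^sup>2)" by (intro sum_nonneg) auto
  also have "\<dots> = (\<Sum>i<q. \<Sum>j<q. q\<^sup>2 * (H i j)\<^sup>2 + (R i)\<^sup>2 + (C j)\<^sup>2 + 2 * (R i * C j)
      - 2 * q * (R i * H i j) - 2 * q * (C j * H i j))"
    by (intro sum.cong refl) (simp add: power2_eq_square algebra_simps)
  also have "\<dots> = q\<^sup>2 * (\<Sum>i<q. \<Sum>j<q. (H i j)\<^sup>2) + q * (\<Sum>i<q. (R i)\<^sup>2) + q * (\<Sum>j<q. (C j)\<^sup>2)
      + 2 * (\<Sum>i<q. \<Sum>j<q. R i * C j)
      - 2 * q * (\<Sum>i<q. \<Sum>j<q. R i * H i j) - 2 * q * (\<Sum>i<q. \<Sum>j<q. C j * H i j)"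
    by (simp add: sum.distrib sum_subtractf sum_distrib_left)
  also have "(\<Sum>i<q. \<Sum>j<q. R i * C j) = 0" by (simp add: R0 flip: sum_product)
  also have "(\<Sum>i<q. \<Sum>j<q. R i * H i j) = (\<Sum>i<q. (R i)\<^sup>2)"
    by (simp add: R_def power2_eq_square flip: sum_distrib_left)
  also have "(\<Sum>i<q. \<Sum>j<q. C j * H i j) = (\<Sum>j<q. (C j)\<^sup>2)"
    by (subst sum.swap) (simp add: C_def power2_eq_square flip: sum_distrib_left)
  also have "(\<Sum>i<q. \<Sum>j<q. (H i j)\<^sup>2) = (\<Sum>x<q * q. (h x)\<^sup>2)" by (simp add: sum_square H_def)
  finally have "0 \<le> q * (q * (\<Sum>x<q * q. (h x)\<^sup>2) - (\<Sum>i<q. (R i)\<^sup>2) - (\<Sum>j<q. (C j)\<^sup>2))"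
    by (simp add: power2_eq_square algebra_simps)
  then have "0 \<le> q * (\<Sum>x<q * q. (h x)\<^sup>2) - (\<Sum>i<q. (R i)\<^sup>2) - (\<Sum>j<q. (C j)\<^sup>2)"
    using q by (simp add: zero_le_mult_iff)
  then show ?thesis unfolding rook_energy[of h] by (simp add: R_def C_def H_def)
qed

lemma rook_poincare_sharp:
  "\<exists>h :: nat \<Rightarrow> real. (\<Sum>x<q * q. h x) = 0 \<and> (\<exists>x\<in>{..<q * q}. h x \<noteq> 0) \<and>
     (\<Sum>x<q * q. \<Sum>y<q * q. rook x y * (h x - h y)\<^sup>2) = 2 * q * (\<Sum>x<q * q. (h x)\<^sup>2)"
proof -
  \<comment> \<open>functions of the row with mean zero attain the gap\<close>
  define u where "u = (\<lambda>i :: nat. of_bool (i = 0) - of_bool (i = 1) :: real)"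
  define h where "h = (\<lambda>x. u (x div q))"
  have h: "h (i * q + j) = u i" if "j < q" for i j using that by (simp add: h_def coords)
  have u0: "(\<Sum>i<q. u i) = 0" using q by (simp add: u_def sum_subtractf of_bool_def)
  have "(\<Sum>x<q * q. h x) = 0"
    unfolding sum_square by (simp add: h flip: sum_distrib_left) (simp add: u0)
  moreover have "h 0 \<noteq> 0" "0 < q * q" using q by (simp_all add: h_def u_def)
  moreover have "(\<Sum>x<q * q. \<Sum>y<q * q. rook x y * (h x - h y)\<^sup>2) = 2 * q * (\<Sum>x<q * q. (h x)\<^sup>2)"
  proof -
    have row: "(\<Sum>j<q. h (i * q + j)) = q * u i" for i by (simp add: h)
    have column: "(\<Sum>i<q. h (i * q + j)) = 0" if "j < q" for j using that by (simp add: h u0)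
    have norm: "(\<Sum>x<q * q. (h x)\<^sup>2) = q * (\<Sum>i<q. (u i)\<^sup>2)"
      unfolding sum_square by (simp add: h sum_distrib_left)
    have "(\<Sum>i<q. (real q * u i)\<^sup>2) = q * (q * (\<Sum>i<q. (u i)\<^sup>2))"
      by (simp add: power2_eq_square sum_distrib_left mult_ac)
    then show ?thesis unfolding rook_energy norm row by (simp add: column)
  qed
  ultimately show ?thesis by (intro exI[of _ h]) auto
qed

lemma codegree_graph_rook:
  assumes "q > 4"
  shows "codegree_graph {..<q * q} rook 2 q"
proof
  show "weighted_graph {..<q * q} rook" by (rule weighted_graph_rook)
  show "rook x y = 0 \<or> rook x y = 1" for x y by (rule rook_cases)
  show "(\<Sum>z<q * q. rook x z * rook z y) = 2"
    if "x \<in> {..<q * q}" "y \<in> {..<q * q}" "x \<noteq> y" "rook x y = 0" for x y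
    using that rook_codegree by simp
  show "\<exists>x\<in>{..<q * q}. \<exists>y\<in>{..<q * q}. x \<noteq> y \<and> rook x y = 0"
  proof (intro bexI conjI)
    show "1 * q + 1 \<in> {..<q * q}" "0 * q + 0 \<in> {..<q * q}"
      using q square_index[of 1 1] square_index[of 0 0] by auto
    show "rook (0 * q + 0) (1 * q + 1) = 0" using q by (subst rook_coords) auto
  qed simp
  show "2 * real q * (\<Sum>x<q * q. (h x)\<^sup>2) \<le> (\<Sum>x<q * q. \<Sum>y<q * q. rook x y * (h x - h y)\<^sup>2)"
    if "(\<Sum>x<q * q. h x) = 0" for h
    using rook_poincare[OF that] by simp
  show "\<exists>h. (\<Sum>x<q * q. h x) = 0 \<and> (\<exists>x\<in>{..<q * q}. h x \<noteq> 0) \<and>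
     (\<Sum>x<q * q. \<Sum>y<q * q. rook x y * (h x - h y)\<^sup>2) = 2 * real q * (\<Sum>x<q * q. (h x)\<^sup>2)"
    using rook_poincare_sharp by simp
  show "(0::real) < 2" "2 * 2 < real q" using assms by simp_all
qed

end

theorem theorem2p4:
  "\<exists>(V :: nat set) (c :: nat \<Rightarrow> nat \<Rightarrow> real) (\<alpha> :: nat \<Rightarrow> real).
     weighted_graph V c \<and> (\<forall>x\<in>V. \<alpha> x > 0) \<and>
     (\<exists>l < 1. ((\<lambda>\<epsilon>. gap V c (\<lambda>x. \<epsilon> * \<alpha> x) 2 / gap V c (\<lambda>x. \<epsilon> * \<alpha> x) 1)
                 \<longlongrightarrow> l) (at_right (0 :: real)))"
proof -
  interpret codegree_graph "{..<5 * 5 :: nat}" "rook 5" 2 "real 5"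
    by (rule codegree_graph_rook) auto
  have "((\<lambda>\<epsilon>. gap {..<5 * 5} (rook 5) (\<lambda>x. \<epsilon> * 1) 2 / gap {..<5 * 5} (rook 5) (\<lambda>x. \<epsilon> * 1) 1)
      \<longlongrightarrow> 2 * 2 / real 5) (at_right 0)"
    unfolding mult_1_right by (rule gap_ratio_tendsto)
  then have "\<exists>l<1. ((\<lambda>\<epsilon>. gap {..<5 * 5} (rook 5) (\<lambda>x. \<epsilon> * 1) 2 / gap {..<5 * 5} (rook 5) (\<lambda>x. \<epsilon> * 1) 1)
      \<longlongrightarrow> l) (at_right 0)"
    by (intro exI[of _ "2 * 2 / real 5"] conjI) simp_all
  with graph show ?thesis
    by (intro exI[of _ "{..<5 * 5}"] exI[of _ "rook 5"] exI[of _ "\<lambda>_. 1"]) simp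
qed

end
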